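(* There is an absolute constant $C>0$ such that the following holds. Let $f:\mathbb{R}^d\to\mathbb{R}$ be glocally $(L,L_*,\delta)$-smooth and $\mu$-strongly convex with $\mu>0$, let $f_*$ be its infimum, and suppose that the Hessian $\nabla^2f(w)$ is constant over the region where $f(w)-f_*\le\delta$. Let $w_0\in\mathbb{R}^d$, $\Delta_0=f(w_0)-f_*$, and let $\epsilon$ satisfy $\Delta_0>\delta>\epsilon>0$. Let $(w_t)$ be the iterates of the nonlinear conjugate gradient method with exact line optimization, with $\beta_t=0$ on the first and every $d$th iteration, and $\beta_t$ set by the Polak-Ribi\`ere-Polyak formula on all other iterations (see the context). Then $f(w_T)-f_*\le\epsilon$ for all integers $T$ with $$T\ge C\left(\frac{L^2}{\mu^2}\log\left(\frac{\Delta_0}{\delta}\right)+1\right)+\min\left\{C\frac{L^2}{\mu^2}\log\left(\frac{\delta}{\epsilon}\right),\ d+\min\left\{d,\ C\sqrt{\frac{L_*}{\mu}}\log\left(\left(\frac{L_*}{\mu}\right)^2\frac{\delta}{\epsilon}\right)\right\}\right\}.$$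
   Context: $\|\cdot\|$ is the Euclidean norm, functions are differentiable, and $L,L_*,\delta>0$. Glocal smoothness: $f$ with infimum $f_*$ is glocally $(L,L_*,\delta)$-smooth if (i) $\|\nabla f(u)-\nabla f(v)\|\le L\|u-v\|$ for all $u,v\in\mathbb{R}^d$, and (ii) $\|\nabla f(u)-\nabla f(v)\|\le L_*\|u-v\|$ for all $u,v$ in the set $\{u: f(u)-f_*\le\delta\}$. Strong convexity: $f$ is $\mu$-strongly convex if $f(v)\ge f(u)+\langle\nabla f(u),v-u\rangle+\frac{\mu}{2}\|v-u\|^2$ for all $u,v\in\mathbb{R}^d$. Method: for $t\ge0$, $w_{t+1}=w_t+\eta_tp_t$ with search direction $p_t=-\nabla f(w_t)+\beta_tp_{t-1}$ and $\eta_t\in\arg\min_\eta f(w_t+\eta p_t)$. Here $\beta_t=0$ when $t$ is a multiple of $d$ (including $t=0$, so $p_0=-\nabla f(w_0)$), and otherwise $$\beta_t=\frac{\|\nabla f(w_t)\|^2-\nabla f(w_t)^T\nabla f(w_{t-1})}{\|\nabla f(w_{t-1})\|^2}.$$ If $\nabla f(w_t)=0$ the method stays at $w_t$. *)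

theory Defs
  imports "HOL-Analysis.Analysis" "HOL-Library.Poly_Mapping"
begin

text \<open>
  The constant in the theorem must not depend on the dimension \<open>d\<close>, so \<open>d\<close> has to be
  quantified inside the statement and cannot be encoded in a type.  We therefore equip the
  finitely supported functions with the \<open>\<ell>\<^sup>2\<close> inner product and represent the Euclidean
  space of dimension \<open>d\<close> as the subspace \<open>Rd d\<close> of \<^typ>\<open>nat \<Rightarrow>\<^sub>0 real\<close>.
  A function on that space is a function on the whole type of which only the values on
  \<open>Rd d\<close> matter; derivatives are taken within \<open>Rd d\<close>.
\<close>

instantiation poly_mapping :: (type, real_inner) real_inner
begin

definition scaleR_poly_mapping :: "real \<Rightarrow> ('a \<Rightarrow>\<^sub>0 'b) \<Rightarrow> 'a \<Rightarrow>\<^sub>0 'b"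
  where "scaleR_poly_mapping r x = Poly_Mapping.map (scaleR r) x"

definition inner_poly_mapping :: "('a \<Rightarrow>\<^sub>0 'b) \<Rightarrow> ('a \<Rightarrow>\<^sub>0 'b) \<Rightarrow> real"
  where "inner_poly_mapping x y = (\<Sum>i\<in>Poly_Mapping.keys x. Poly_Mapping.lookup x i \<bullet> Poly_Mapping.lookup y i)"

definition norm_poly_mapping :: "('a \<Rightarrow>\<^sub>0 'b) \<Rightarrow> real"
  where "norm_poly_mapping x = sqrt (x \<bullet> x)"

definition sgn_poly_mapping :: "('a \<Rightarrow>\<^sub>0 'b) \<Rightarrow> 'a \<Rightarrow>\<^sub>0 'b"
  where "sgn_poly_mapping x = inverse (norm x) *\<^sub>R x"

definition dist_poly_mapping :: "('a \<Rightarrow>\<^sub>0 'b) \<Rightarrow> ('a \<Rightarrow>\<^sub>0 'b) \<Rightarrow> real"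
  where "dist_poly_mapping x y = norm (x - y)"

definition uniformity_poly_mapping :: "(('a \<Rightarrow>\<^sub>0 'b) \<times> ('a \<Rightarrow>\<^sub>0 'b)) filter"
  where "uniformity_poly_mapping = (INF e\<in>{0<..}. principal {(x, y). dist x y < e})"

definition open_poly_mapping :: "('a \<Rightarrow>\<^sub>0 'b) set \<Rightarrow> bool"
  where "open_poly_mapping U \<longleftrightarrow> (\<forall>x\<in>U. \<forall>\<^sub>F (x', y) in uniformity. x' = x \<longrightarrow> y \<in> U)"

lemma lookup_scaleR_aux: "Poly_Mapping.lookup (r *\<^sub>R x) i = r *\<^sub>R Poly_Mapping.lookup x i"
  for x :: "'a \<Rightarrow>\<^sub>0 'b"
  by (simp add: scaleR_poly_mapping_def map.rep_eq when_def)

lemma inner_superset_aux: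
  fixes x y :: "'a \<Rightarrow>\<^sub>0 'b"
  assumes "finite A" "Poly_Mapping.keys x \<subseteq> A"
  shows "x \<bullet> y = (\<Sum>i\<in>A. Poly_Mapping.lookup x i \<bullet> Poly_Mapping.lookup y i)"
  unfolding inner_poly_mapping_def
  by (rule sum.mono_neutral_left) (use assms in \<open>auto simp: in_keys_iff\<close>)

instance
proof
  fix x y z :: "'a \<Rightarrow>\<^sub>0 'b" and r s :: real
  show "r *\<^sub>R (x + y) = r *\<^sub>R x + r *\<^sub>R y"
    by (rule poly_mapping_eqI) (simp add: lookup_scaleR_aux lookup_add scaleR_add_right)
  show "(r + s) *\<^sub>R x = r *\<^sub>R x + s *\<^sub>R x"
    by (rule poly_mapping_eqI) (simp add: lookup_scaleR_aux lookup_add scaleR_add_left)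
  show "r *\<^sub>R s *\<^sub>R x = (r * s) *\<^sub>R x"
    by (rule poly_mapping_eqI) (simp add: lookup_scaleR_aux)
  show "1 *\<^sub>R x = x"
    by (rule poly_mapping_eqI) (simp add: lookup_scaleR_aux)
  let ?A = "Poly_Mapping.keys x \<union> Poly_Mapping.keys y \<union> Poly_Mapping.keys z
    \<union> Poly_Mapping.keys (x + y) \<union> Poly_Mapping.keys (r *\<^sub>R x)"
  have A: "u \<bullet> v = (\<Sum>i\<in>?A. Poly_Mapping.lookup u i \<bullet> Poly_Mapping.lookup v i)"
    if "u \<in> {x, y, z, x + y, r *\<^sub>R x}" for u v :: "'a \<Rightarrow>\<^sub>0 'b"
    using that by (intro inner_superset_aux) auto
  show "x \<bullet> y = y \<bullet> x"
    by (simp add: A inner_commute)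
  show "(x + y) \<bullet> z = x \<bullet> z + y \<bullet> z"
    by (simp add: A lookup_add inner_add_left sum.distrib)
  show "(r *\<^sub>R x) \<bullet> y = r * (x \<bullet> y)"
    by (simp add: A lookup_scaleR_aux sum_distrib_left)
  show "0 \<le> x \<bullet> x"
    by (simp add: inner_poly_mapping_def sum_nonneg)
  show "x \<bullet> x = 0 \<longleftrightarrow> x = 0"
    by (auto simp: inner_poly_mapping_def sum_nonneg_eq_0_iff in_keys_iff intro!: poly_mapping_eqI)
qed (fact dist_poly_mapping_def sgn_poly_mapping_def uniformity_poly_mapping_def
      open_poly_mapping_def norm_poly_mapping_def)+

end

lemma lookup_scaleR: "Poly_Mapping.lookup (r *\<^sub>R x) i = r *\<^sub>R Poly_Mapping.lookup x i"
  by (rule lookup_scaleR_aux)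

definition Rd :: "nat \<Rightarrow> (nat \<Rightarrow>\<^sub>0 real) set"
  where "Rd d = {x. Poly_Mapping.keys x \<subseteq> {..<d}}"

lemma mem_Rd_iff: "x \<in> Rd d \<longleftrightarrow> (\<forall>i\<ge>d. Poly_Mapping.lookup x i = 0)"
  by (fastforce simp: Rd_def subset_iff in_keys_iff not_le[symmetric])

lemma subspace_Rd: "subspace (Rd d)"
  by (simp add: subspace_def mem_Rd_iff lookup_add lookup_scaleR)

lemma inner_Rd:
  assumes "x \<in> Rd d"
  shows "x \<bullet> y = (\<Sum>i<d. Poly_Mapping.lookup x i * Poly_Mapping.lookup y i)"
  using inner_superset_aux[of "{..<d}" x y] assms by (simp add: Rd_def)

lemma norm_Rd:
  assumes "x \<in> Rd d"
  shows "norm x = L2_set (Poly_Mapping.lookup x) {..<d}"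
  using inner_Rd[OF assms, of x] by (simp add: norm_poly_mapping_def L2_set_def power2_eq_square)

definition grad :: "nat \<Rightarrow> ((nat \<Rightarrow>\<^sub>0 real) \<Rightarrow> real) \<Rightarrow> (nat \<Rightarrow>\<^sub>0 real) \<Rightarrow> (nat \<Rightarrow>\<^sub>0 real)"
  where "grad d f u = (THE g. g \<in> Rd d \<and> (f has_derivative (\<lambda>h. g \<bullet> h)) (at u within Rd d))"

lemma grad_props:
  assumes "f differentiable (at u within Rd d)" "u \<in> Rd d"
  shows "grad d f u \<in> Rd d"
    and "(f has_derivative (\<lambda>h. grad d f u \<bullet> h)) (at u within Rd d)"
proof -
  obtain D where D: "(f has_derivative D) (at u within Rd d)"
    using assms(1) by (auto simp: differentiable_def)
  interpret D: bounded_linear D using D by (rule has_derivative_bounded_linear)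
  define e :: "nat \<Rightarrow> nat \<Rightarrow>\<^sub>0 real" where "e i = Poly_Mapping.single i 1" for i
  define g where "g = (\<Sum>i<d. D (e i) *\<^sub>R e i)"
  have e: "e i \<in> Rd d" if "i < d" for i using that by (simp add: e_def Rd_def)
  have g: "g \<in> Rd d" unfolding g_def
    by (intro subspace_sum subspace_scale subspace_Rd e) auto
  have ei: "e i \<bullet> h = Poly_Mapping.lookup h i" for i h
    by (simp add: e_def inner_poly_mapping_def)
  have Dh: "D h = g \<bullet> h" if "h \<in> Rd d" for h
  proof -
    have "h = (\<Sum>i<d. Poly_Mapping.lookup h i *\<^sub>R e i)"
      using that by (intro poly_mapping_eqI)
        (auto simp: lookup_sum lookup_scaleR e_def lookup_single when_def Rd_def in_keys_iff subset_iff
          if_distrib[of "\<lambda>x. _ * x"] cong: if_cong)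
    then have "D h = D (\<Sum>i<d. Poly_Mapping.lookup h i *\<^sub>R e i)" by simp
    also have "\<dots> = g \<bullet> h"
      by (simp add: D.sum D.scaleR g_def inner_sum_left ei mult.commute)
    finally show ?thesis .
  qed
  have der: "(f has_derivative (\<lambda>h. g \<bullet> h)) (at u within Rd d)"
    unfolding has_derivative_within
  proof (intro conjI bounded_linear_inner_right)
    have "((\<lambda>y. (1 / norm (y - u)) *\<^sub>R (f y - (f u + D (y - u)))) \<longlongrightarrow> 0) (at u within Rd d)"
      using D by (simp add: has_derivative_within)
    then show "((\<lambda>y. (1 / norm (y - u)) *\<^sub>R (f y - (f u + g \<bullet> (y - u)))) \<longlongrightarrow> 0) (at u within Rd d)"
      by (rule Lim_transform_eventually)
        (auto simp: eventually_at_filter Dh subspace_diff[OF subspace_Rd] assms(2) intro!: always_eventually)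
  qed
  have uniq: "g' = g" if g': "g' \<in> Rd d" "(f has_derivative (\<lambda>h. g' \<bullet> h)) (at u within Rd d)" for g'
  proof -
    define v where "v = g' - g"
    have v: "v \<in> Rd d" unfolding v_def by (intro subspace_diff subspace_Rd g g')
    have "((\<lambda>h. f (u + h *\<^sub>R v)) has_derivative (\<lambda>h. k \<bullet> (h *\<^sub>R v))) (at (0::real))"
      if "(f has_derivative (\<lambda>h. k \<bullet> h)) (at u within Rd d)" for k
    proof -
      have "((\<lambda>h. u + h *\<^sub>R v) has_derivative (\<lambda>h. h *\<^sub>R v)) (at (0::real))"
        by (auto intro!: derivative_eq_intros)
      moreover have "(\<lambda>h. u + h *\<^sub>R v) ` UNIV \<subseteq> Rd d"
        by (auto intro!: subspace_add subspace_scale subspace_Rd v assms(2))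
      moreover have "(f has_derivative (\<lambda>h. k \<bullet> h)) (at (u + 0 *\<^sub>R v) within (\<lambda>h. u + h *\<^sub>R v) ` UNIV)"
        using that calculation(2) by (auto intro: has_derivative_subset)
      ultimately show ?thesis
        using has_derivative_in_compose[of "\<lambda>h. u + h *\<^sub>R v" "\<lambda>h. h *\<^sub>R v" 0 UNIV f "\<lambda>h. k \<bullet> h"] by simp
    qed
    from has_derivative_unique[OF this[OF der] this[OF g'(2)]]
    have "g \<bullet> v = g' \<bullet> v" by (metis scaleR_one)
    then have "v \<bullet> v = 0" by (simp add: v_def inner_diff_left)
    then show ?thesis by (simp add: v_def)
  qed
  have "\<exists>!g. g \<in> Rd d \<and> (f has_derivative (\<lambda>h. g \<bullet> h)) (at u within Rd d)"
    using g der uniq by blast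
  from theI'[OF this] show "grad d f u \<in> Rd d"
    and "(f has_derivative (\<lambda>h. grad d f u \<bullet> h)) (at u within Rd d)"
    by (simp_all add: grad_def)
qed

definition inf_val :: "nat \<Rightarrow> ((nat \<Rightarrow>\<^sub>0 real) \<Rightarrow> real) \<Rightarrow> real"
  where "inf_val d f = (INF u\<in>Rd d. f u)"

definition sublevel :: "nat \<Rightarrow> ((nat \<Rightarrow>\<^sub>0 real) \<Rightarrow> real) \<Rightarrow> real \<Rightarrow> (nat \<Rightarrow>\<^sub>0 real) set"
  where "sublevel d f \<delta> = {u \<in> Rd d. f u - inf_val d f \<le> \<delta>}"

definition glocally_smooth ::
  "nat \<Rightarrow> ((nat \<Rightarrow>\<^sub>0 real) \<Rightarrow> real) \<Rightarrow> real \<Rightarrow> real \<Rightarrow> real \<Rightarrow> bool"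
  where "glocally_smooth d f L Ls \<delta> \<longleftrightarrow>
    0 < L \<and> 0 < Ls \<and> 0 < \<delta> \<and>
    f differentiable_on Rd d \<and> bdd_below (f ` Rd d) \<and>
    (\<forall>u\<in>Rd d. \<forall>v\<in>Rd d. norm (grad d f u - grad d f v) \<le> L * norm (u - v)) \<and>
    (\<forall>u\<in>sublevel d f \<delta>. \<forall>v\<in>sublevel d f \<delta>. norm (grad d f u - grad d f v) \<le> Ls * norm (u - v))"

definition strongly_convex :: "nat \<Rightarrow> ((nat \<Rightarrow>\<^sub>0 real) \<Rightarrow> real) \<Rightarrow> real \<Rightarrow> bool"
  where "strongly_convex d f \<mu> \<longleftrightarrow>
    f differentiable_on Rd d \<and>
    (\<forall>u\<in>Rd d. \<forall>v\<in>Rd d. f v \<ge> f u + grad d f u \<bullet> (v - u) + \<mu> / 2 * (norm (v - u))\<^sup>2)"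

text \<open>
  The Hessian at \<open>w\<close> is the derivative of the gradient map at \<open>w\<close> relative to the whole space
  \<open>Rd d\<close> (not relative to \<open>S\<close>).  A derivative within \<open>Rd d\<close> is determined only on \<open>Rd d\<close>, so
  constancy is expressed by one linear map serving at all points of \<open>S\<close>.
\<close>

definition constant_Hessian_on ::
  "nat \<Rightarrow> ((nat \<Rightarrow>\<^sub>0 real) \<Rightarrow> real) \<Rightarrow> (nat \<Rightarrow>\<^sub>0 real) set \<Rightarrow> bool"
  where "constant_Hessian_on d f S \<longleftrightarrow>
    (\<exists>H. \<forall>w\<in>S. (grad d f has_derivative H) (at w within Rd d))"

definition prp_beta ::
  "nat \<Rightarrow> ((nat \<Rightarrow>\<^sub>0 real) \<Rightarrow> real) \<Rightarrow> (nat \<Rightarrow> nat \<Rightarrow>\<^sub>0 real) \<Rightarrow> nat \<Rightarrow> real"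
  where "prp_beta d f w t =
    (if d dvd t then 0
     else ((norm (grad d f (w t)))\<^sup>2 - grad d f (w t) \<bullet> grad d f (w (t - 1)))
            / (norm (grad d f (w (t - 1))))\<^sup>2)"

text \<open>
  At \<open>t = 0\<close> the term \<open>p (t - 1)\<close> is multiplied by \<open>prp_beta d f w 0 = 0\<close>.  A direction and a
  step size are only constrained while the gradient is nonzero; if the gradient at \<open>w t\<close> is
  nonzero, so are all earlier ones, hence \<open>p (t - 1)\<close> is then determined and the denominator
  of \<open>prp_beta\<close> is nonzero.
\<close>

definition prp_cg_iterates ::
  "nat \<Rightarrow> ((nat \<Rightarrow>\<^sub>0 real) \<Rightarrow> real) \<Rightarrow> (nat \<Rightarrow> nat \<Rightarrow>\<^sub>0 real) \<Rightarrow> bool"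
  where "prp_cg_iterates d f w \<longleftrightarrow>
    w 0 \<in> Rd d \<and>
    (\<exists>(p :: nat \<Rightarrow> nat \<Rightarrow>\<^sub>0 real) (\<eta> :: nat \<Rightarrow> real). \<forall>t.
      if grad d f (w t) = 0 then w (Suc t) = w t
      else p t = - grad d f (w t) + prp_beta d f w t *\<^sub>R p (t - 1) \<and>
           is_arg_min (\<lambda>s. f (w t + s *\<^sub>R p t)) (\<lambda>_. True) (\<eta> t) \<and>
           w (Suc t) = w t + \<eta> t *\<^sub>R p t)"

end

theory Submission
  imports Defs
begin

text \<open>
  The constant is \<open>C = 4\<close>.  The proof has a global part, which uses only \<open>L\<close> and \<open>\<mu>\<close>, and a local
  part, which uses that \<open>f\<close> is a quadratic on the region \<open>f - f\<^sub>* \<le> \<delta>\<close>.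

  Globally, every step of the method shrinks \<open>f - f\<^sub>*\<close> by the factor \<open>1 - \<mu>\<^sup>2 / (2 L\<^sup>2)\<close>
  (\<open>gap_contraction\<close>).  With exact line search the direction \<open>p\<^sub>t\<close> has slope \<open>- \<parallel>g\<^sub>t\<parallel>\<^sup>2\<close>, so the decrease
  is at least \<open>\<parallel>g\<^sub>t\<parallel>\<^sup>4 / (2 L \<parallel>p\<^sub>t\<parallel>\<^sup>2)\<close>, and the Polak-Lojasiewicz inequality reduces the claim to
  \<open>\<parallel>p\<^sub>t\<parallel>\<^sup>2 \<le> (1 + L / \<mu>) \<parallel>g\<^sub>t\<parallel>\<^sup>2\<close> (\<open>direction_bound\<close>), where cocoercivity of the gradient enters.  This
  gives the first alternative of the minimum, and it brings the iterates into the region where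
  \<open>f - f\<^sub>* \<le> \<delta>\<close> after \<open>2 (L / \<mu>)\<^sup>2 log (\<Delta>\<^sub>0 / \<delta>)\<close> steps, rounded up.  They never leave it again, and less than \<open>d\<close>
  steps later there is a restart, from which on the method is linear conjugate gradients on a quadratic.

  In the region the gradient is affine with linear part \<open>H\<close>.  The region has interior points, so the
  bounds \<open>\<mu>\<close> and \<open>L\<^sub>*\<close> and the symmetry of \<open>H\<close> follow from increments around one of them, by scaling
  (\<open>hessian_coercive_form\<close>).  Over the \<open>d\<close> steps after the restart the gradients are mutually orthogonal, so one of the
  first \<open>d + 1\<close> of them vanishes (\<open>finite_termination\<close>).  Waiting for the restart and running to
  termination thus takes at most \<open>2 d\<close> steps.

  The accelerated bound comes from comparison with Nesterov's method.  Conjugate gradients minimise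
  the quadratic over growing Krylov spaces.  Nesterov's potential, energy plus
  \<open>\<mu> / 2 \<parallel>z\<parallel>\<^sup>2\<close>, contracts by \<open>1 - sqrt (\<mu> / L\<^sub>*)\<close> in a step that stays inside the next Krylov space, and
  replacing the result of that step by the minimiser over the space only lowers the energy
  (\<open>krylov_minimisers_rate\<close>).
\<close>

section \<open>Smooth strongly convex functions on a subspace\<close>

locale smooth_strongly_convex =
  fixes V :: "'a::real_inner set" and f :: "'a \<Rightarrow> real" and g :: "'a \<Rightarrow> 'a" and L \<mu> :: real
  assumes subspace_V: "subspace V"
    and gradient_in: "u \<in> V \<Longrightarrow> g u \<in> V"
    and gradient: "u \<in> V \<Longrightarrow> (f has_derivative (\<lambda>h. g u \<bullet> h)) (at u within V)"
    and lipschitz: "u \<in> V \<Longrightarrow> v \<in> V \<Longrightarrow> norm (g u - g v) \<le> L * norm (u - v)"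
    and strong_convexity:
      "u \<in> V \<Longrightarrow> v \<in> V \<Longrightarrow> f v \<ge> f u + g u \<bullet> (v - u) + \<mu> / 2 * (norm (v - u))\<^sup>2"
    and L_pos: "0 < L" and \<mu>_pos: "0 < \<mu>"
begin

lemma on_line_in: "u \<in> V \<Longrightarrow> p \<in> V \<Longrightarrow> u + s *\<^sub>R p \<in> V"
  by (intro subspace_add subspace_scale subspace_V)

lemma diff_in: "u \<in> V \<Longrightarrow> v \<in> V \<Longrightarrow> u - v \<in> V"
  by (intro subspace_diff subspace_V)

lemma derivative_on_line:
  assumes "u \<in> V" "p \<in> V"
  shows "((\<lambda>s. f (u + s *\<^sub>R p)) has_real_derivative g (u + s *\<^sub>R p) \<bullet> p) (at s)"
proof -
  have "((\<lambda>h. u + h *\<^sub>R p) has_derivative (\<lambda>h. h *\<^sub>R p)) (at s)"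
    by (auto intro!: derivative_eq_intros)
  moreover have "(\<lambda>h. u + h *\<^sub>R p) ` UNIV \<subseteq> V"
    using assms by (auto intro: on_line_in)
  then have "(f has_derivative (\<lambda>h. g (u + s *\<^sub>R p) \<bullet> h))
      (at (u + s *\<^sub>R p) within (\<lambda>h. u + h *\<^sub>R p) ` UNIV)"
    using gradient[OF on_line_in[OF assms]] by (rule has_derivative_subset[rotated])
  ultimately have "((\<lambda>h. f (u + h *\<^sub>R p)) has_derivative (\<lambda>h. g (u + s *\<^sub>R p) \<bullet> (h *\<^sub>R p))) (at s)"
    by (rule has_derivative_in_compose)
  then show ?thesis
    by (rule has_derivative_imp_has_field_derivative) simp
qed

lemma descent:
  assumes u: "u \<in> V" and v: "v \<in> V"
  shows "f v \<le> f u + g u \<bullet> (v - u) + L / 2 * (norm (v - u))\<^sup>2"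
proof -
  define p where "p = v - u"
  have p: "p \<in> V" unfolding p_def by (intro diff_in u v)
  define \<phi> where "\<phi> s = f (u + s *\<^sub>R p) - s * (g u \<bullet> p) - L / 2 * s\<^sup>2 * (norm p)\<^sup>2" for s
  have "\<phi> 1 \<le> \<phi> 0"
  proof (rule DERIV_nonpos_imp_nonincreasing[of 0 1 \<phi>])
    fix s :: real assume s: "0 \<le> s"
    have "(\<phi> has_real_derivative g (u + s *\<^sub>R p) \<bullet> p - g u \<bullet> p - L * s * (norm p)\<^sup>2) (at s)"
      unfolding \<phi>_def
      by (rule derivative_eq_intros derivative_on_line u p refl | simp)+
    moreover have "g (u + s *\<^sub>R p) \<bullet> p - g u \<bullet> p \<le> L * s * (norm p)\<^sup>2"
    proof -
      have "g (u + s *\<^sub>R p) \<bullet> p - g u \<bullet> p = (g (u + s *\<^sub>R p) - g u) \<bullet> p"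
        by (simp add: inner_diff_left)
      also have "\<dots> \<le> norm (g (u + s *\<^sub>R p) - g u) * norm p"
        by (rule norm_cauchy_schwarz)
      also have "\<dots> \<le> (L * norm (u + s *\<^sub>R p - u)) * norm p"
        by (intro mult_right_mono lipschitz on_line_in u p) simp
      finally show ?thesis
        using s by (simp add: power2_eq_square mult.assoc)
    qed
    ultimately show "\<exists>y. (\<phi> has_real_derivative y) (at s) \<and> y \<le> 0"
      by (intro exI conjI) auto
  qed simp
  then show ?thesis
    by (simp add: \<phi>_def p_def algebra_simps)
qed

lemma convexity: "u \<in> V \<Longrightarrow> v \<in> V \<Longrightarrow> f v \<ge> f u + g u \<bullet> (v - u)"
  using strong_convexity[of u v] \<mu>_pos by (smt (verit) divide_pos_pos mult_nonneg_nonneg zero_le_power2)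

text \<open>
  Evaluating convexity at \<open>u\<close> and the descent inequality at \<open>v\<close> in the gradient step
  \<open>v - (g v - g u) / L\<close> sharpens the tangent inequality by \<open>\<parallel>g v - g u\<parallel>\<^sup>2 / (2 L)\<close>; adding the
  same bound with \<open>u\<close> and \<open>v\<close> exchanged gives cocoercivity.
\<close>

lemma cocoercivity:
  assumes u: "u \<in> V" and v: "v \<in> V"
  shows "(norm (g u - g v))\<^sup>2 \<le> L * ((g u - g v) \<bullet> (u - v))"
proof -
  have half: "f b \<ge> f a + g a \<bullet> (b - a) + (norm (g b - g a))\<^sup>2 / (2 * L)"
    if a: "a \<in> V" and b: "b \<in> V" for a b
  proof -
    define y where "y = g b - g a"
    define z where "z = b + (- (1 / L)) *\<^sub>R y"
    have y: "y \<in> V" unfolding y_def by (intro diff_in gradient_in a b)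
    have z: "z \<in> V" unfolding z_def by (intro on_line_in b y)
    have 1: "f z \<ge> f a + g a \<bullet> (z - a)" by (rule convexity[OF a z])
    have 2: "f z \<le> f b + g b \<bullet> (z - b) + L / 2 * (norm (z - b))\<^sup>2" by (rule descent[OF b z])
    have 3: "L / 2 * (norm (z - b))\<^sup>2 = (norm y)\<^sup>2 / (2 * L)"
      using L_pos by (simp add: z_def power_mult_distrib power2_eq_square field_simps)
    have 4: "g b \<bullet> (z - b) = - (g b \<bullet> y) / L" by (simp add: z_def)
    have 5: "g a \<bullet> (z - a) = g a \<bullet> (b - a) - (g a \<bullet> y) / L"
      by (simp add: z_def inner_diff_right inner_add_right)
    have "(g b \<bullet> y) / L - (g a \<bullet> y) / L = y \<bullet> y / L"
      by (simp add: y_def inner_diff_left diff_divide_distrib)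
    then have 6: "(g b \<bullet> y) / L - (g a \<bullet> y) / L = 2 * ((norm y)\<^sup>2 / (2 * L))"
      by (simp add: dot_square_norm)
    show ?thesis
      using 1 2 unfolding 3 4 5 using 6 by (simp add: y_def)
  qed
  have "g u \<bullet> (v - u) + g v \<bullet> (u - v) + (norm (g u - g v))\<^sup>2 / L \<le> 0"
    using half[OF u v] half[OF v u] by (simp add: norm_minus_commute)
  moreover have "(g u - g v) \<bullet> (u - v) = - (g u \<bullet> (v - u) + g v \<bullet> (u - v))"
    by (simp add: inner_diff_left inner_diff_right)
  ultimately have "(norm (g u - g v))\<^sup>2 / L \<le> (g u - g v) \<bullet> (u - v)" by linarith
  then show ?thesis using L_pos by (simp add: pos_divide_le_eq mult.commute)
qed

lemma strong_monotonicity: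
  assumes u: "u \<in> V" and v: "v \<in> V"
  shows "\<mu> * (norm (u - v))\<^sup>2 \<le> (g u - g v) \<bullet> (u - v)"
  using strong_convexity[OF u v] strong_convexity[OF v u]
  by (simp add: inner_diff_left inner_diff_right norm_minus_commute)

text \<open>
  This is the Polyak-Lojasiewicz inequality: minimise the quadratic lower bound at \<open>u\<close> over \<open>v\<close>.
  It is stated for the infimum of \<open>f\<close>, since no minimiser is known to exist at this point.
\<close>

lemma gap_le_gradient:
  assumes u: "u \<in> V"
  shows "2 * \<mu> * (f u - (INF v\<in>V. f v)) \<le> (norm (g u))\<^sup>2"
proof -
  have "f u - (norm (g u))\<^sup>2 / (2 * \<mu>) \<le> f v" if v: "v \<in> V" for v
  proof -
    have "0 \<le> (norm (g u + \<mu> *\<^sub>R (v - u)))\<^sup>2" by simp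
    also have "\<dots> = (norm (g u))\<^sup>2 + 2 * \<mu> * (g u \<bullet> (v - u)) + \<mu>\<^sup>2 * (norm (v - u))\<^sup>2"
      unfolding power2_norm_eq_inner inner_add_left inner_add_right
      by (simp add: inner_commute power2_eq_square)
    finally have "- (norm (g u))\<^sup>2 \<le> 2 * \<mu> * (g u \<bullet> (v - u) + \<mu> / 2 * (norm (v - u))\<^sup>2)"
      by (simp add: algebra_simps power2_eq_square)
    also have "\<dots> \<le> 2 * \<mu> * (f v - f u)"
      using strong_convexity[OF u v] \<mu>_pos by (intro mult_left_mono) auto
    finally show ?thesis using \<mu>_pos by (simp add: field_simps)
  qed
  then have "f u - (norm (g u))\<^sup>2 / (2 * \<mu>) \<le> (INF v\<in>V. f v)"
    using u by (intro cINF_greatest) auto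
  then show ?thesis using \<mu>_pos by (simp add: field_simps)
qed

lemma modulus_le_lipschitz:
  assumes "p \<in> V" "p \<noteq> 0"
  shows "\<mu> \<le> L"
proof -
  have 0: "0 \<in> V" by (rule subspace_0[OF subspace_V])
  have "\<mu> / 2 * (norm p)\<^sup>2 \<le> L / 2 * (norm p)\<^sup>2"
    using strong_convexity[OF 0 assms(1)] descent[OF 0 assms(1)] by simp
  then show ?thesis using assms(2) by simp
qed

end

section \<open>Nonlinear conjugate gradients with exact line search\<close>

text \<open>
  The restart period \<open>d\<close> is tied to the dimension of \<open>V\<close> only later, by a spanning set of at most \<open>d\<close>
  vectors.
\<close>

locale polak_ribiere = smooth_strongly_convex V f g L \<mu>
  for V :: "'a::real_inner set" and f g L \<mu> +
  fixes d :: nat and w p :: "nat \<Rightarrow> 'a" and \<beta> \<eta> :: "nat \<Rightarrow> real"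
  assumes start: "w 0 \<in> V"
    and restart: "d dvd t \<Longrightarrow> \<beta> t = 0"
    and prp: "\<not> d dvd t \<Longrightarrow>
      \<beta> t = ((norm (g (w t)))\<^sup>2 - g (w t) \<bullet> g (w (t - 1))) / (norm (g (w (t - 1))))\<^sup>2"
    and stop: "g (w t) = 0 \<Longrightarrow> w (Suc t) = w t"
    and direction: "g (w t) \<noteq> 0 \<Longrightarrow> p t = - g (w t) + \<beta> t *\<^sub>R p (t - 1)"
    and line_search: "g (w t) \<noteq> 0 \<Longrightarrow> f (w t + \<eta> t *\<^sub>R p t) \<le> f (w t + s *\<^sub>R p t)"
    and update: "g (w t) \<noteq> 0 \<Longrightarrow> w (Suc t) = w t + \<eta> t *\<^sub>R p t"
begin

lemma nonzero_before:
  assumes "g (w t) \<noteq> 0" "s \<le> t"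
  shows "g (w s) \<noteq> 0"
proof
  assume 0: "g (w s) = 0"
  have "w t = w s"
    using assms(2) by (induction rule: dec_induct) (use 0 in \<open>auto simp: stop\<close>)
  with assms(1) 0 show False by simp
qed

lemma iterates_in: "w t \<in> V \<and> (g (w t) \<noteq> 0 \<longrightarrow> p t \<in> V)"
proof (induction t)
  case 0
  have "p 0 = - g (w 0)" if "g (w 0) \<noteq> 0" using direction[OF that] restart[of 0] by simp
  then show ?case using start by (auto intro: subspace_neg[OF subspace_V] gradient_in)
next
  case (Suc t)
  have w: "w (Suc t) \<in> V"
    by (cases "g (w t) = 0") (use Suc in \<open>auto simp: stop update intro: on_line_in\<close>)
  have "p (Suc t) \<in> V" if "g (w (Suc t)) \<noteq> 0"
    unfolding direction[OF that] using Suc nonzero_before[OF that, of t] w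
    by (intro on_line_in subspace_neg[OF subspace_V] gradient_in) auto
  with w show ?case by simp
qed

lemmas w_in = iterates_in[THEN conjunct1]
lemmas p_in = iterates_in[THEN conjunct2, rule_format]

lemma gradient_orthogonal_direction:
  assumes "g (w t) \<noteq> 0"
  shows "g (w (Suc t)) \<bullet> p t = 0"
proof -
  have "((\<lambda>s. f (w t + s *\<^sub>R p t)) has_real_derivative g (w (Suc t)) \<bullet> p t) (at (\<eta> t))"
    unfolding update[OF assms] by (rule derivative_on_line[OF w_in p_in[OF assms]])
  then show ?thesis
    by (rule DERIV_local_min[of _ _ _ 1]) (auto intro: line_search[OF assms])
qed

lemma directional_slope:
  assumes nz: "g (w t) \<noteq> 0"
  shows "g (w t) \<bullet> p t = - (norm (g (w t)))\<^sup>2"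
proof (cases t)
  case 0
  then show ?thesis using direction[OF nz] restart[of 0] by (simp add: power2_norm_eq_inner)
next
  case (Suc n)
  then have "g (w t) \<bullet> p n = 0"
    using gradient_orthogonal_direction[of n] nonzero_before[OF nz, of n] by simp
  then show ?thesis
    using Suc direction[OF nz] by (simp add: inner_diff_right power2_norm_eq_inner)
qed

lemma direction_nonzero: "g (w t) \<noteq> 0 \<Longrightarrow> p t \<noteq> 0"
  using directional_slope[of t] by auto

lemma step_nonzero:
  assumes nz: "g (w t) \<noteq> 0"
  shows "\<eta> t \<noteq> 0"
proof
  assume "\<eta> t = 0"
  then have "w (Suc t) = w t" by (simp add: update[OF nz])
  then show False
    using gradient_orthogonal_direction[OF nz] directional_slope[OF nz] nz by simp
qed

text \<open>
  Let \<open>s\<close> be the previous step and \<open>y\<close> the change of gradient along it.  The exact line search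
  turns the correction \<open>\<beta> t *\<^sub>R p (t - 1)\<close> into \<open>((g (w t) \<bullet> y) / (s \<bullet> y)) *\<^sub>R s\<close>, whose length is at
  most \<open>\<parallel>g (w t)\<parallel> \<parallel>y\<parallel> \<parallel>s\<parallel> / (s \<bullet> y)\<close>.  Bounding \<open>\<parallel>y\<parallel>\<close> by cocoercivity instead of by the
  Lipschitz condition costs only one factor \<open>L / \<mu>\<close> in the square, and this is what
  gives the rate \<open>(L / \<mu>)\<^sup>2\<close> rather than \<open>(L / \<mu>)\<^sup>3\<close>.
\<close>

lemma direction_bound:
  assumes nz: "g (w t) \<noteq> 0"
  shows "(norm (p t))\<^sup>2 \<le> (1 + L / \<mu>) * (norm (g (w t)))\<^sup>2"
proof -
  have ratio: "0 \<le> L / \<mu>" using L_pos \<mu>_pos by simp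
  have corr: "(\<beta> t)\<^sup>2 * (norm (p (t - 1)))\<^sup>2 \<le> L / \<mu> * (norm (g (w t)))\<^sup>2
      \<and> \<beta> t * (g (w t) \<bullet> p (t - 1)) = 0"
  proof (cases "d dvd t")
    case True
    then show ?thesis using L_pos \<mu>_pos by (simp add: restart)
  next
    case False
    then obtain n where t: "t = Suc n" by (cases t) auto
    have nzn: "g (w n) \<noteq> 0" using nonzero_before[OF nz, of n] t by simp
    define y where "y = g (w t) - g (w n)"
    define G where "G = (norm (g (w n)))\<^sup>2"
    define P where "P = (norm (p n))\<^sup>2"
    have G: "G > 0" using nzn by (simp add: G_def)
    have P: "P > 0" using direction_nonzero[OF nzn] by (simp add: P_def)
    have orth: "g (w t) \<bullet> p n = 0" using gradient_orthogonal_direction[OF nzn] t by simp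
    have s: "w t - w n = \<eta> n *\<^sub>R p n" using update[OF nzn] t by simp
    have ys: "y \<bullet> (w t - w n) = \<eta> n * G"
      using orth directional_slope[OF nzn] by (simp add: s y_def inner_diff_left G_def)
    have "\<mu> * ((\<eta> n)\<^sup>2 * P) \<le> \<eta> n * G"
      using strong_monotonicity[OF w_in w_in, of t n, folded y_def] unfolding ys
      by (simp add: s power_mult_distrib P_def)
    moreover have "0 < \<mu> * ((\<eta> n)\<^sup>2 * P)"
      using \<mu>_pos P step_nonzero[OF nzn] by simp
    ultimately have "0 < \<eta> n * G" by linarith
    then have \<eta>: "0 < \<eta> n" using G by (simp add: zero_less_mult_iff)
    have "\<eta> n * (\<mu> * \<eta> n * P) \<le> \<eta> n * G"
      using \<open>\<mu> * ((\<eta> n)\<^sup>2 * P) \<le> \<eta> n * G\<close> by (simp add: power2_eq_square algebra_simps)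
    then have \<eta>_le: "\<mu> * \<eta> n * P \<le> G" using \<eta> by simp
    have y_le: "(norm y)\<^sup>2 \<le> L * (\<eta> n * G)"
      using cocoercivity[OF w_in w_in, of t n] ys by (simp add: y_def)
    have \<beta>: "\<beta> t = (g (w t) \<bullet> y) / G"
      using prp[OF False] t by (simp add: y_def G_def inner_diff_right power2_norm_eq_inner)
    have "(g (w t) \<bullet> y)\<^sup>2 \<le> (norm (g (w t)))\<^sup>2 * (norm y)\<^sup>2"
      using Cauchy_Schwarz_ineq[of "g (w t)" y] by (simp add: power2_norm_eq_inner)
    also have "\<dots> \<le> (norm (g (w t)))\<^sup>2 * (L * (\<eta> n * G))"
      using y_le by (intro mult_left_mono) auto
    finally have "(\<beta> t)\<^sup>2 * P \<le> (norm (g (w t)))\<^sup>2 * (L * (\<eta> n * G)) / G\<^sup>2 * P"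
      using P G unfolding \<beta> power_divide by (intro mult_right_mono divide_right_mono) auto
    also have "\<dots> = L / \<mu> * (norm (g (w t)))\<^sup>2 * ((\<mu> * \<eta> n * P) / G)"
      using G \<mu>_pos by (simp add: power2_eq_square field_simps)
    also have "\<dots> \<le> L / \<mu> * (norm (g (w t)))\<^sup>2 * 1"
      using \<eta>_le G L_pos \<mu>_pos by (intro mult_left_mono) (auto simp: pos_divide_le_eq)
    finally show ?thesis using orth t by (simp add: P_def)
  qed
  have "(norm (p t))\<^sup>2 = (norm (g (w t)))\<^sup>2 + (\<beta> t)\<^sup>2 * (norm (p (t - 1)))\<^sup>2
      - 2 * (\<beta> t * (g (w t) \<bullet> p (t - 1)))"
    unfolding direction[OF nz] power2_norm_eq_inner
    by (simp add: inner_add_left inner_add_right inner_commute power2_eq_square algebra_simps)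
  also have "\<dots> \<le> (norm (g (w t)))\<^sup>2 + L / \<mu> * (norm (g (w t)))\<^sup>2"
    using corr by linarith
  finally show ?thesis by (simp only: distrib_right mult_1)
qed

text \<open>
  The line search does at least as well as the minimiser \<open>s = \<parallel>g (w t)\<parallel>\<^sup>2 / (L \<parallel>p t\<parallel>\<^sup>2)\<close> of the descent
  inequality along \<open>p t\<close>.
\<close>

lemma gap_contraction:
  assumes bdd: "bdd_below (f ` V)"
  defines "m \<equiv> INF v\<in>V. f v"
  shows "f (w (Suc t)) - m \<le> (1 - \<mu>\<^sup>2 / (2 * L\<^sup>2)) * (f (w t) - m)"
proof -
  have gap: "m \<le> f (w t)" unfolding m_def by (rule cINF_lower[OF bdd w_in])
  have PL: "2 * \<mu> * (f (w t) - m) \<le> (norm (g (w t)))\<^sup>2"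
    unfolding m_def by (rule gap_le_gradient[OF w_in])
  show ?thesis
  proof (cases "g (w t) = 0")
    case True
    then have "f (w t) \<le> m" using PL \<mu>_pos by (simp add: mult_le_0_iff)
    with gap show ?thesis using True by (simp add: stop)
  next
    case nz: False
    define G where "G = (norm (g (w t)))\<^sup>2"
    define P where "P = (norm (p t))\<^sup>2"
    have G: "G > 0" using nz by (simp add: G_def)
    have P: "P > 0" using direction_nonzero[OF nz] by (simp add: P_def)
    have P_le: "P \<le> (1 + L / \<mu>) * G" using direction_bound[OF nz] by (simp add: P_def G_def)
    have \<mu>_le: "\<mu> \<le> L" by (rule modulus_le_lipschitz[OF p_in[OF nz] direction_nonzero[OF nz]])
    define s where "s = G / (L * P)"
    have "f (w (Suc t)) \<le> f (w t + s *\<^sub>R p t)"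
      unfolding update[OF nz] by (rule line_search[OF nz])
    also have "\<dots> \<le> f (w t) - s * G + L / 2 * (s\<^sup>2 * P)"
      using descent[OF w_in[of t] on_line_in[OF w_in p_in[OF nz], of t s]] directional_slope[OF nz]
      by (simp add: G_def P_def power_mult_distrib)
    also have "\<dots> = f (w t) - G / (2 * L) * (G / P)"
      using L_pos P by (simp add: s_def power2_eq_square field_simps)
    finally have 1: "f (w (Suc t)) \<le> f (w t) - G / (2 * L) * (G / P)" .
    have "1 + L / \<mu> \<le> 2 * L / \<mu>" using \<mu>_le \<mu>_pos by (simp add: field_simps)
    then have "P \<le> 2 * L / \<mu> * G" using P_le G by (meson mult_right_mono less_imp_le order_trans)
    then have 2: "\<mu> / (2 * L) \<le> G / P"
      using \<mu>_pos L_pos P by (simp add: field_simps)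
    have 3: "2 * \<mu> * (f (w t) - m) \<le> G"
      using PL by (simp add: G_def)
    have "\<mu>\<^sup>2 / (2 * L\<^sup>2) * (f (w t) - m) = 2 * \<mu> * (f (w t) - m) / (2 * L) * (\<mu> / (2 * L))"
      using L_pos by (simp add: power2_eq_square field_simps)
    also have "\<dots> \<le> G / (2 * L) * (G / P)"
      using 2 3 gap G P \<mu>_pos L_pos by (intro mult_mono divide_right_mono) auto
    finally show ?thesis using 1 by (simp add: algebra_simps)
  qed
qed

end

section \<open>Conjugate gradients on a quadratic\<close>

lemma pairwise_orthogonal_family_bound:
  fixes x :: "nat \<Rightarrow> 'a::real_inner"
  assumes nz: "\<And>i. i \<le> n \<Longrightarrow> x i \<noteq> 0"
    and orth: "\<And>i j. j \<le> n \<Longrightarrow> i < j \<Longrightarrow> x j \<bullet> x i = 0"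
    and B: "finite B" "\<And>i. i \<le> n \<Longrightarrow> x i \<in> span B"
  shows "n < card B"
proof -
  have o: "x i \<bullet> x j = 0" if "i \<le> n" "j \<le> n" "i \<noteq> j" for i j
    using orth[of i j] orth[of j i] that by (cases i j rule: linorder_cases) (auto simp: inner_commute)
  have inj: "inj_on x {..n}"
  proof (rule inj_onI, rule ccontr)
    fix i j assume "i \<in> {..n}" "j \<in> {..n}" "x i = x j" "i \<noteq> j"
    then show False using o[of i j] nz[of j] by simp
  qed
  have "pairwise orthogonal (x ` {..n})"
    by (auto simp: pairwise_def orthogonal_def intro!: o)
  then have "independent (x ` {..n})"
    by (rule pairwise_orthogonal_independent) (use nz in auto)
  then have "card (x ` {..n}) \<le> card B"
    using independent_span_bound[OF B(1), of "x ` {..n}"] B(2) by auto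
  then show ?thesis by (simp add: card_image[OF inj])
qed

text \<open>
  \<open>G\<close> stands for the gradients and \<open>p\<close> for the directions.  The coefficient of \<open>p k\<close> is exactly what makes
  \<open>p (Suc k)\<close> conjugate to \<open>p k\<close>; the earlier directions are handled by
  \<open>H (p i) = (G (Suc i) - G i) / \<eta> i\<close> and the orthogonality of the gradients.
\<close>

lemma conjugate_directions:
  fixes G p :: "nat \<Rightarrow> 'a::real_inner" and H :: "'a \<Rightarrow> 'a"
  assumes p0: "p 0 = - G 0"
    and pS: "\<And>k. Suc k < n \<Longrightarrow>
      p (Suc k) = - G (Suc k) + (G (Suc k) \<bullet> (G (Suc k) - G k) / (G k \<bullet> G k)) *\<^sub>R p k"
    and GS: "\<And>k. k < n \<Longrightarrow> G (Suc k) = G k + \<eta> k *\<^sub>R H (p k)"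
    and ls: "\<And>k. k < n \<Longrightarrow> G (Suc k) \<bullet> p k = 0"
    and nz: "\<And>k. k < n \<Longrightarrow> \<eta> k \<noteq> 0" "\<And>k. k < n \<Longrightarrow> G k \<noteq> 0"
    and sym: "\<And>i j. i < n \<Longrightarrow> j < n \<Longrightarrow> H (p i) \<bullet> p j = p i \<bullet> H (p j)"
    and k: "k \<le> n"
  shows "i < k \<Longrightarrow> G k \<bullet> p i = 0"
    and "i < k \<Longrightarrow> G k \<bullet> G i = 0"
    and "i < k \<Longrightarrow> k < n \<Longrightarrow> p k \<bullet> H (p i) = 0"
proof -
  have "\<forall>i<k. G k \<bullet> p i = 0 \<and> G k \<bullet> G i = 0 \<and> (k < n \<longrightarrow> p k \<bullet> H (p i) = 0)"
    using k
  proof (induction k)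
    case 0
    then show ?case by simp
  next
    case (Suc k)
    then have kn: "k < n" by simp
    note IH = Suc.IH[OF less_imp_le[OF kn]]
    have a: "G (Suc k) \<bullet> p i = 0" if "i < Suc k" for i
    proof (cases "i = k")
      case True
      then show ?thesis using ls[OF kn] by simp
    next
      case False
      with that have "i < k" by simp
      then show ?thesis
        using IH sym[OF kn, of i] kn by (simp add: GS[OF kn] inner_add_left)
    qed
    have b: "G (Suc k) \<bullet> G i = 0" if "i < Suc k" for i
    proof (cases i)
      case 0
      then show ?thesis using a[of 0] p0 by simp
    next
      case (Suc m)
      then have "G i = (G i \<bullet> (G i - G m) / (G m \<bullet> G m)) *\<^sub>R p m - p i"
        using pS[of m] that kn by simp
      then have "G (Suc k) \<bullet> G i = (G i \<bullet> (G i - G m) / (G m \<bullet> G m)) * (G (Suc k) \<bullet> p m) - G (Suc k) \<bullet> p i"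
        by (metis inner_diff_right inner_scaleR_right)
      then show ?thesis
        using a[of i] a[of m] that Suc by simp
    qed
    have H: "H (p i) = (1 / \<eta> i) *\<^sub>R (G (Suc i) - G i)" if "i < n" for i
      using GS[OF that] nz(1)[OF that] by simp
    have c: "p (Suc k) \<bullet> H (p i) = 0" if "i < Suc k" "Suc k < n" for i
    proof (cases "i = k")
      case True
      have kk: "p k \<bullet> G k = - (G k \<bullet> G k)"
      proof (cases k)
        case 0
        then show ?thesis using p0 by simp
      next
        case (Suc m)
        then show ?thesis using pS[of m] ls[of m] kn by (simp add: inner_diff_left inner_diff_right inner_commute)
      qed
      have "p k \<bullet> (G (Suc k) - G k) = G k \<bullet> G k"
        using kk ls[OF kn] by (simp add: inner_diff_right inner_commute)
      then have "p (Suc k) \<bullet> (G (Suc k) - G k) = 0"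
        unfolding pS[OF that(2)] inner_add_left inner_scaleR_left inner_minus_left
        using nz(2)[OF kn] by simp
      then show ?thesis using True H[OF kn] by simp
    next
      case False
      with that have i: "i < k" by simp
      have "G (Suc k) \<bullet> H (p i) = 0"
        using b[of "Suc i"] b[of i] i H[of i] kn by (simp add: inner_diff_right)
      moreover have "p k \<bullet> H (p i) = 0" using IH i kn by simp
      ultimately show ?thesis
        unfolding pS[OF that(2)] by (simp add: inner_diff_left)
    qed
    show ?case using a b c by simp
  qed
  then show "i < k \<Longrightarrow> G k \<bullet> p i = 0"
    and "i < k \<Longrightarrow> G k \<bullet> G i = 0"
    and "i < k \<Longrightarrow> k < n \<Longrightarrow> p k \<bullet> H (p i) = 0" by auto
qed

locale coercive_form =
  fixes V :: "'a::real_inner set" and H :: "'a \<Rightarrow> 'a" and M \<mu> :: real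
  assumes form_subspace: "subspace V"
    and lin: "linear H"
    and form_in: "v \<in> V \<Longrightarrow> H v \<in> V"
    and sym: "u \<in> V \<Longrightarrow> v \<in> V \<Longrightarrow> H u \<bullet> v = H v \<bullet> u"
    and coercive: "v \<in> V \<Longrightarrow> \<mu> * (norm v)\<^sup>2 \<le> H v \<bullet> v"
    and bounded: "v \<in> V \<Longrightarrow> norm (H v) \<le> M * norm v"
    and form_pos: "0 < \<mu>" "\<mu> \<le> M"
begin

definition energy :: "'a \<Rightarrow> real"
  where "energy v = (H v \<bullet> v) / 2"

lemma energy_add:
  assumes "u \<in> V" "v \<in> V"
  shows "energy (u + v) = energy u + H u \<bullet> v + energy v"
  using sym[OF assms] by (simp add: energy_def linear_add[OF lin] inner_add_left inner_add_right field_simps)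

lemma energy_lower: "v \<in> V \<Longrightarrow> \<mu> / 2 * (norm v)\<^sup>2 \<le> energy v"
  using coercive[of v] by (simp add: energy_def)

lemma energy_scale: "energy (s *\<^sub>R v) = s\<^sup>2 * energy v"
  by (simp add: energy_def linear_scale[OF lin] power2_eq_square)

lemma energy_gradient_step:
  assumes y: "y \<in> V"
  shows "energy (y - (1 / M) *\<^sub>R H y) \<le> energy y - (norm (H y))\<^sup>2 / (2 * M)"
proof -
  have M: "M > 0" using form_pos by simp
  define h where "h = H y"
  have h: "h \<in> V" unfolding h_def by (rule form_in[OF y])
  have "energy (y + (- (1 / M)) *\<^sub>R h) = energy y - (norm h)\<^sup>2 / M + (1 / M)\<^sup>2 * energy h"
    unfolding energy_add[OF y subspace_scale[OF form_subspace h]] energy_scale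
    by (simp add: h_def[symmetric] power2_norm_eq_inner)
  moreover have "energy h \<le> M * (norm h)\<^sup>2 / 2"
  proof -
    have "H h \<bullet> h \<le> norm (H h) * norm h" by (rule norm_cauchy_schwarz)
    also have "\<dots> \<le> (M * norm h) * norm h" by (intro mult_right_mono bounded[OF h]) simp
    finally show ?thesis by (simp add: energy_def power2_eq_square mult.assoc)
  qed
  then have "(1 / M)\<^sup>2 * energy h \<le> (1 / M)\<^sup>2 * (M * (norm h)\<^sup>2 / 2)"
    by (intro mult_left_mono) auto
  moreover have "(1 / M)\<^sup>2 * (M * (norm h)\<^sup>2 / 2) = (norm h)\<^sup>2 / M - (norm h)\<^sup>2 / (2 * M)"
    using M by (simp add: power2_eq_square field_simps)
  ultimately show ?thesis by (simp add: h_def)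
qed

text \<open>
  One step of Nesterov's method for the energy, whose minimiser is \<open>0\<close>: \<open>y\<close> is the extrapolated point,
  \<open>z\<close> the auxiliary sequence, and energy plus \<open>\<mu> / 2 \<parallel>z\<parallel>\<^sup>2\<close> the potential.  Convexity of the squared norm
  controls the new \<open>z\<close>; the tangent inequalities at \<open>y\<close> towards \<open>0\<close> and \<open>x\<close>, with weights \<open>\<theta>\<close> and
  \<open>1 - \<theta>\<close>, control the new energy; and since \<open>\<theta>\<^sup>2 = \<mu> / M\<close>, the squared gradient terms cancel.
\<close>

lemma accelerated_step:
  fixes x z :: 'a
  defines "\<theta> \<equiv> sqrt (\<mu> / M)"
  defines "y \<equiv> (1 / (1 + \<theta>)) *\<^sub>R (x + \<theta> *\<^sub>R z)"
  defines "z' \<equiv> (1 - \<theta>) *\<^sub>R z + \<theta> *\<^sub>R y - (\<theta> / \<mu>) *\<^sub>R H y"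
  assumes x: "x \<in> V" and z: "z \<in> V"
  shows "energy (y - (1 / M) *\<^sub>R H y) + \<mu> / 2 * (norm z')\<^sup>2
    \<le> (1 - \<theta>) * (energy x + \<mu> / 2 * (norm z)\<^sup>2)"
proof -
  have M: "M > 0" using form_pos by simp
  have \<theta>: "0 < \<theta>" "\<theta> \<le> 1" "\<theta>\<^sup>2 = \<mu> / M"
    using form_pos M by (auto simp: \<theta>_def)
  have y: "y \<in> V" unfolding y_def by (intro subspace_scale subspace_add form_subspace x z)
  define h where "h = H y"
  define m where "m = (1 - \<theta>) *\<^sub>R z + \<theta> *\<^sub>R y"
  have xyz: "(1 + \<theta>) *\<^sub>R y = x + \<theta> *\<^sub>R z" using \<theta> by (simp add: y_def)
  have "(norm m)\<^sup>2 = (1 - \<theta>) * (norm z)\<^sup>2 + \<theta> * (norm y)\<^sup>2 - \<theta> * (1 - \<theta>) * (norm (z - y))\<^sup>2"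
    unfolding m_def power2_norm_eq_inner inner_add_left inner_add_right inner_diff_left inner_diff_right
    by (simp add: inner_commute algebra_simps)
  moreover have "0 \<le> \<theta> * (1 - \<theta>) * (norm (z - y))\<^sup>2" using \<theta> by simp
  ultimately have m: "(norm m)\<^sup>2 \<le> (1 - \<theta>) * (norm z)\<^sup>2 + \<theta> * (norm y)\<^sup>2" by linarith
  have "(norm z')\<^sup>2 = (norm m)\<^sup>2 - 2 * (\<theta> / \<mu>) * (h \<bullet> m) + (\<theta> / \<mu>)\<^sup>2 * (norm h)\<^sup>2"
    unfolding z'_def m_def[symmetric] h_def[symmetric] power2_norm_eq_inner
    by (simp add: inner_diff_left inner_diff_right inner_commute power2_eq_square algebra_simps)
  then have "\<mu> / 2 * (norm z')\<^sup>2 = \<mu> / 2 * (norm m)\<^sup>2 - \<theta> * (h \<bullet> m) + \<theta>\<^sup>2 / (2 * \<mu>) * (norm h)\<^sup>2"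
    using form_pos(1) by (simp add: power2_eq_square field_simps)
  also have "\<theta>\<^sup>2 / (2 * \<mu>) * (norm h)\<^sup>2 = (norm h)\<^sup>2 / (2 * M)"
    using form_pos(1) by (simp add: \<theta>)
  finally have z': "\<mu> / 2 * (norm z')\<^sup>2 \<le> \<mu> / 2 * ((1 - \<theta>) * (norm z)\<^sup>2 + \<theta> * (norm y)\<^sup>2)
      - \<theta> * (h \<bullet> m) + (norm h)\<^sup>2 / (2 * M)"
    using mult_left_mono[OF m, of "\<mu> / 2"] form_pos(1) by linarith
  have "energy y = h \<bullet> y - energy y" by (simp add: energy_def h_def field_simps)
  then have e0: "energy y \<le> h \<bullet> y - \<mu> / 2 * (norm y)\<^sup>2" using energy_lower[OF y] by linarith
  have "energy x = energy y + h \<bullet> (x - y) + energy (x - y)"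
    using energy_add[OF y subspace_diff[OF form_subspace x y]] by (simp add: h_def)
  moreover have "0 \<le> energy (x - y)"
    using energy_lower[OF subspace_diff[OF form_subspace x y]] form_pos(1)
    by (smt (verit) half_gt_zero_iff mult_nonneg_nonneg zero_le_power2)
  ultimately have e1: "energy y \<le> energy x - h \<bullet> (x - y)" by linarith
  have "energy y = \<theta> * energy y + (1 - \<theta>) * energy y" by (simp add: algebra_simps)
  also have "\<dots> \<le> \<theta> * (h \<bullet> y - \<mu> / 2 * (norm y)\<^sup>2) + (1 - \<theta>) * (energy x - h \<bullet> (x - y))"
    using e0 e1 \<theta> by (intro add_mono mult_left_mono) auto
  finally have e: "energy y \<le> \<dots>" .
  \<comment> \<open>The choice of \<open>y\<close> is the one that makes all terms linear in \<open>H y\<close> cancel.\<close>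
  have "\<theta> * (h \<bullet> y) - (1 - \<theta>) * (h \<bullet> (x - y)) - \<theta> * (h \<bullet> m)
      = (1 - \<theta>) * (h \<bullet> ((1 + \<theta>) *\<^sub>R y - (x + \<theta> *\<^sub>R z)))"
    by (simp add: m_def inner_add_right inner_diff_right algebra_simps)
  then have cancel: "\<theta> * (h \<bullet> y) - (1 - \<theta>) * (h \<bullet> (x - y)) - \<theta> * (h \<bullet> m) = 0"
    by (simp add: xyz)
  have combine: "a + b \<le> (1 - t) * (x + q * zz)"
    if "a \<le> e - s" "b \<le> q * ((1 - t) * zz + t * yy) - t * hm + s"
      "e \<le> t * (hy - q * yy) + (1 - t) * (x - hx)" "t * hy - (1 - t) * hx - t * hm = 0"
    for a b e s t q x zz yy hx hy hm :: real
    using that by (simp add: algebra_simps)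
  show ?thesis
    by (rule combine[OF _ z' e cancel]) (use energy_gradient_step[OF y] in \<open>simp add: h_def\<close>)
qed

text \<open>
  The hypothesis on \<open>H (e k)\<close> says that \<open>e k\<close> minimises the energy over \<open>e 0 + K k\<close>.  Nesterov's
  gradient step from \<open>y\<close> stays in \<open>e 0 + K (Suc k)\<close>, so \<open>e (Suc k)\<close> is at least as good, and the iterates
  inherit the accelerated rate without any spectral theory or Chebyshev polynomials.
\<close>

lemma krylov_minimisers_rate:
  fixes e :: "nat \<Rightarrow> 'a" and K :: "nat \<Rightarrow> 'a set"
  assumes K: "\<And>k. subspace (K k)" "\<And>k. k \<le> n \<Longrightarrow> K k \<subseteq> V" "mono K"
    and e: "e 0 \<in> V" "\<And>k. k \<le> n \<Longrightarrow> e k - e 0 \<in> K k"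
    and H0: "0 < n \<Longrightarrow> H (e 0) \<in> K 1"
    and HK: "\<And>k v. k < n \<Longrightarrow> v \<in> K k \<Longrightarrow> H v \<in> K (Suc k)"
    and opt: "\<And>k v. k \<le> n \<Longrightarrow> v \<in> K k \<Longrightarrow> H (e k) \<bullet> v = 0"
  shows "energy (e n) \<le> 2 * (1 - sqrt (\<mu> / M)) ^ n * energy (e 0)"
proof -
  define \<theta> where "\<theta> = sqrt (\<mu> / M)"
  have \<theta>: "0 < \<theta>" "\<theta> \<le> 1" using form_pos by (auto simp: \<theta>_def)
  have eV: "e k \<in> V" if "k \<le> n" for k
  proof -
    have "e 0 + (e k - e 0) \<in> V"
      using e that K(2)[OF that] by (intro subspace_add form_subspace) auto
    then show ?thesis by simp
  qed
  have "\<exists>z. z - e 0 \<in> K k \<and>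
      energy (e k) + \<mu> / 2 * (norm z)\<^sup>2 \<le> (1 - \<theta>) ^ k * (energy (e 0) + \<mu> / 2 * (norm (e 0))\<^sup>2)"
    if "k \<le> n" for k
    using that
  proof (induction k)
    case 0
    show ?case by (rule exI[of _ "e 0"]) (simp add: subspace_0[OF K(1)])
  next
    case (Suc k)
    then obtain z where z: "z - e 0 \<in> K k"
      and bound: "energy (e k) + \<mu> / 2 * (norm z)\<^sup>2
        \<le> (1 - \<theta>) ^ k * (energy (e 0) + \<mu> / 2 * (norm (e 0))\<^sup>2)"
      by auto
    have kn: "k < n" "k \<le> n" using Suc.prems by auto
    have KS: "v \<in> K (Suc k)" if "v \<in> K k" for v
      using monoD[OF K(3), of k "Suc k"] that by auto
    have zV: "z \<in> V"
    proof -
      have "e 0 + (z - e 0) \<in> V"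
        using e z K(2)[OF kn(2)] by (intro subspace_add form_subspace) auto
      then show ?thesis by simp
    qed
    define y where "y = (1 / (1 + \<theta>)) *\<^sub>R (e k + \<theta> *\<^sub>R z)"
    define z' where "z' = (1 - \<theta>) *\<^sub>R z + \<theta> *\<^sub>R y - (\<theta> / \<mu>) *\<^sub>R H y"
    define x' where "x' = y - (1 / M) *\<^sub>R H y"
    have y0: "y - e 0 \<in> K k"
    proof -
      have "y - e 0 = (1 / (1 + \<theta>)) *\<^sub>R ((e k - e 0) + \<theta> *\<^sub>R (z - e 0))"
      proof -
        have "(1 + \<theta>) *\<^sub>R (y - e 0) = (e k - e 0) + \<theta> *\<^sub>R (z - e 0)"
          using \<theta> by (simp add: y_def scaleR_diff_right scaleR_add_left)
        then show ?thesis using \<theta>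
          by (metis add_pos_pos divide_self_if less_numeral_extra(1,3) scaleR_one scaleR_scaleR times_divide_eq_left mult_1)
      qed
      then show ?thesis
        using e(2)[OF kn(2)] z by (simp only:) (intro subspace_scale subspace_add K(1))
    qed
    have Hy: "H y \<in> K (Suc k)"
    proof -
      have "H (e 0) \<in> K (Suc k)"
        using H0 kn monoD[OF K(3), of 1 "Suc k"] by auto
      then have "H (e 0) + H (y - e 0) \<in> K (Suc k)"
        by (intro subspace_add K(1) HK[OF kn(1) y0])
      then show ?thesis by (simp flip: linear_add[OF lin])
    qed
    have "z' - e 0 = (1 - \<theta>) *\<^sub>R (z - e 0) + \<theta> *\<^sub>R (y - e 0) - (\<theta> / \<mu>) *\<^sub>R H y"
      by (simp add: z'_def algebra_simps)
    then have z'0: "z' - e 0 \<in> K (Suc k)"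
      by (simp only:) (intro subspace_diff subspace_add subspace_scale K(1) KS z y0 Hy)
    have "x' - e (Suc k) = (y - e 0) - (1 / M) *\<^sub>R H y - (e (Suc k) - e 0)"
      by (simp add: x'_def)
    then have v: "x' - e (Suc k) \<in> K (Suc k)"
      by (simp only:) (intro subspace_diff subspace_scale K(1) KS y0 Hy e(2) Suc.prems)
    then have vV: "x' - e (Suc k) \<in> V" using K(2)[OF Suc.prems] by auto
    have "energy x' = energy (e (Suc k)) + energy (x' - e (Suc k))"
      using energy_add[OF eV[OF Suc.prems] vV] opt[OF Suc.prems v] by simp
    moreover have "0 \<le> energy (x' - e (Suc k))"
      using energy_lower[OF vV] form_pos(1)
      by (smt (verit) half_gt_zero_iff mult_nonneg_nonneg zero_le_power2)
    ultimately have "energy (e (Suc k)) + \<mu> / 2 * (norm z')\<^sup>2 \<le> energy x' + \<mu> / 2 * (norm z')\<^sup>2"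
      by simp
    also have "\<dots> \<le> (1 - \<theta>) * (energy (e k) + \<mu> / 2 * (norm z)\<^sup>2)"
      using accelerated_step[OF eV[OF kn(2)] zV]
      by (simp add: x'_def z'_def y_def \<theta>_def)
    also have "\<dots> \<le> (1 - \<theta>) * ((1 - \<theta>) ^ k * (energy (e 0) + \<mu> / 2 * (norm (e 0))\<^sup>2))"
      using \<theta> by (intro mult_left_mono bound) auto
    finally show ?case using z'0 by (intro exI[of _ z']) (simp add: mult.assoc)
  qed
  from this[of n] obtain z where
    "z - e 0 \<in> K n"
    "energy (e n) + \<mu> / 2 * (norm z)\<^sup>2 \<le> (1 - \<theta>) ^ n * (energy (e 0) + \<mu> / 2 * (norm (e 0))\<^sup>2)"
    by auto
  moreover have "0 \<le> \<mu> / 2 * (norm z)\<^sup>2" using form_pos by simp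
  moreover have "(1 - \<theta>) ^ n * (energy (e 0) + \<mu> / 2 * (norm (e 0))\<^sup>2)
      \<le> (1 - \<theta>) ^ n * (2 * energy (e 0))"
    using energy_lower[OF e(1)] \<theta> by (intro mult_left_mono) auto
  ultimately show ?thesis by (simp add: \<theta>_def mult_ac)
qed

end

section \<open>Constant Hessian on a sublevel set\<close>

locale quadratic_sublevel = smooth_strongly_convex V f g L \<mu>
  for V :: "'a::real_inner set" and f g L \<mu> +
  fixes c M :: real and H :: "'a \<Rightarrow> 'a"
  assumes strict_sublevel: "\<exists>u\<in>V. f u < c"
    and nontrivial: "\<exists>v\<in>V. v \<noteq> 0"
    and hessian: "u \<in> V \<Longrightarrow> f u \<le> c \<Longrightarrow> (g has_derivative H) (at u within V)"
    and lipschitz_sublevel: "u \<in> V \<Longrightarrow> v \<in> V \<Longrightarrow> f u \<le> c \<Longrightarrow> f v \<le> c \<Longrightarrow>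
      norm (g u - g v) \<le> M * norm (u - v)"
begin

lemma segment_in_sublevel:
  assumes u: "u \<in> V" "f u \<le> c" and v: "v \<in> V" "f v \<le> c" and s: "0 \<le> s" "s \<le> 1"
  shows "f (u + s *\<^sub>R (v - u)) \<le> c"
proof -
  define z where "z = u + s *\<^sub>R (v - u)"
  have z: "z \<in> V" unfolding z_def by (intro on_line_in diff_in u v)
  have 1: "f u \<ge> f z + - s * (g z \<bullet> (v - u))"
    using convexity[OF z u(1)] by (simp add: z_def)
  have "v - z = (1 - s) *\<^sub>R (v - u)" by (simp add: z_def algebra_simps)
  then have 2: "f v \<ge> f z + (1 - s) * (g z \<bullet> (v - u))"
    using convexity[OF z v(1)] by simp
  have "(1 - s) * (f z + - s * (g z \<bullet> (v - u))) + s * (f z + (1 - s) * (g z \<bullet> (v - u)))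
      \<le> (1 - s) * c + s * c"
    using 1 2 u v s by (intro add_mono mult_left_mono) auto
  then have "f z \<le> c" by (simp add: algebra_simps)
  then show ?thesis by (simp only: z_def)
qed

lemma gradient_affine:
  assumes u: "u \<in> V" "f u \<le> c" and v: "v \<in> V" "f v \<le> c"
  shows "g v - g u = H (v - u)"
proof -
  define p where "p = v - u"
  have p: "p \<in> V" unfolding p_def by (intro diff_in u v)
  have lin: "linear H" by (rule has_derivative_linear[OF hessian[OF u]])
  define \<gamma> where "\<gamma> s = g (u + s *\<^sub>R p) - s *\<^sub>R H p" for s :: real
  have "\<exists>a. \<forall>s\<in>{0..1}. \<gamma> s = a"
  proof (rule has_derivative_zero_constant)
    fix s :: real assume s: "s \<in> {0..1}"
    have line: "((\<lambda>s. u + s *\<^sub>R p) has_derivative (\<lambda>h. h *\<^sub>R p)) (at s within {0..1})"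
      by (auto intro!: derivative_eq_intros)
    have "(\<lambda>s. u + s *\<^sub>R p) ` {0..1} \<subseteq> V" by (auto intro: on_line_in u p)
    moreover have "(g has_derivative H) (at (u + s *\<^sub>R p) within V)"
      using s unfolding p_def by (intro hessian segment_in_sublevel on_line_in diff_in u v) auto
    ultimately have "(g has_derivative H) (at (u + s *\<^sub>R p) within (\<lambda>s. u + s *\<^sub>R p) ` {0..1})"
      by (rule has_derivative_subset[rotated])
    with line have "((\<lambda>s. g (u + s *\<^sub>R p)) has_derivative (\<lambda>h. H (h *\<^sub>R p))) (at s within {0..1})"
      by (rule has_derivative_in_compose)
    then have "((\<lambda>s. g (u + s *\<^sub>R p)) has_derivative (\<lambda>h. h *\<^sub>R H p)) (at s within {0..1})"
      by (simp add: linear_scale[OF lin])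
    then show "(\<gamma> has_derivative (\<lambda>h. 0)) (at s within {0..1})"
      unfolding \<gamma>_def by (auto intro!: derivative_eq_intros)
  qed (rule convex_real_interval)
  then have "\<gamma> 1 = \<gamma> 0" by auto
  then show ?thesis by (simp add: \<gamma>_def p_def algebra_simps)
qed

lemma quadratic_expansion:
  assumes u: "u \<in> V" "f u \<le> c" and v: "v \<in> V" "f v \<le> c"
  shows "f v = f u + g u \<bullet> (v - u) + (H (v - u) \<bullet> (v - u)) / 2"
proof -
  define p where "p = v - u"
  have p: "p \<in> V" unfolding p_def by (intro diff_in u v)
  have lin: "linear H" by (rule has_derivative_linear[OF hessian[OF u]])
  define \<phi> where "\<phi> s = f (u + s *\<^sub>R p) - s * (g u \<bullet> p) - s\<^sup>2 * (H p \<bullet> p) / 2" for s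
  have "\<exists>a. \<forall>s\<in>{0..1}. \<phi> s = a"
  proof (rule has_field_derivative_zero_constant)
    fix s :: real assume s: "s \<in> {0..1}"
    have "g (u + s *\<^sub>R p) - g u = H (u + s *\<^sub>R p - u)"
      using s unfolding p_def by (intro gradient_affine segment_in_sublevel on_line_in diff_in u v) auto
    then have g: "g (u + s *\<^sub>R p) = g u + s *\<^sub>R H p"
      by (simp add: linear_scale[OF lin] algebra_simps)
    have "(\<phi> has_real_derivative g (u + s *\<^sub>R p) \<bullet> p - g u \<bullet> p - 2 * s * (H p \<bullet> p) / 2) (at s)"
      unfolding \<phi>_def
      by (rule derivative_eq_intros derivative_on_line u p refl | simp)+
    then show "(\<phi> has_real_derivative 0) (at s within {0..1})"
      by (auto simp: g inner_add_left intro: has_field_derivative_at_within)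
  qed (rule convex_real_interval)
  then have "\<phi> 1 = \<phi> 0" by auto
  then show ?thesis by (simp add: \<phi>_def p_def)
qed

lemma interior_point:
  obtains u r where "u \<in> V" "0 < r" "f u \<le> c"
    "\<And>v. v \<in> V \<Longrightarrow> norm v \<le> r \<Longrightarrow> f (u + v) \<le> c"
proof -
  obtain u where u: "u \<in> V" "f u < c" using strict_sublevel by auto
  have "continuous (at u within V) f" by (rule has_derivative_continuous[OF gradient[OF u(1)]])
  then obtain r where r: "r > 0" "\<And>x. x \<in> V \<Longrightarrow> dist x u < r \<Longrightarrow> dist (f x) (f u) < c - f u"
    using u(2) unfolding continuous_within_eps_delta by (metis diff_gt_0_iff_gt)
  show thesis
  proof (rule that[of u "r / 2"])
    fix v assume v: "v \<in> V" "norm v \<le> r / 2"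
    have "dist (f (u + v)) (f u) < c - f u"
      using v r(1) by (intro r(2) subspace_add subspace_V u) (auto simp: dist_norm)
    then show "f (u + v) \<le> c" by (simp add: dist_real_def)
  qed (use u r in auto)
qed

text \<open>
  Within the ball of \<open>interior_point\<close>, \<open>H\<close> is an increment of the gradient and inherits its properties.
  Each of them is invariant under positive scaling, so it extends to all of \<open>V\<close>.
\<close>

lemma hessian_coercive_form: "coercive_form V H M \<mu>"
proof -
  obtain u r where u: "u \<in> V" "f u \<le> c" and r: "0 < r"
    and ball: "\<And>v. v \<in> V \<Longrightarrow> norm v \<le> r \<Longrightarrow> f (u + v) \<le> c"
    using interior_point by metis
  have lin: "linear H" by (rule has_derivative_linear[OF hessian[OF u]])
  have inc: "H v = g (u + v) - g u" if "v \<in> V" "norm v \<le> r" for v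
    using gradient_affine[OF u subspace_add[OF subspace_V u(1) that(1)] ball[OF that]] by simp
  have shrink: "0 < q / (norm v + 1)" "norm ((q / (norm v + 1)) *\<^sub>R v) \<le> q"
    if "0 < q" for v :: 'a and q
  proof -
    have pos: "0 < norm v + 1" using norm_ge_zero[of v] by linarith
    then show "0 < q / (norm v + 1)" using that by simp
    show "norm ((q / (norm v + 1)) *\<^sub>R v) \<le> q" using that pos by (simp add: field_simps)
  qed
  have small: "P v"
    if "v \<in> V" and "\<And>v. v \<in> V \<Longrightarrow> norm v \<le> r \<Longrightarrow> P v"
      and "\<And>a v. 0 < a \<Longrightarrow> v \<in> V \<Longrightarrow> P (a *\<^sub>R v) \<Longrightarrow> P v" for P v
    using that(3)[OF shrink(1)[OF r] that(1)] that(2)[OF subspace_scale[OF subspace_V that(1)] shrink(2)[OF r]]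
    by blast
  have H_in: "H v \<in> V" if "v \<in> V" for v
  proof (rule small[OF that])
    fix v assume "v \<in> V" "norm v \<le> r"
    then show "H v \<in> V" using u by (simp add: inc diff_in gradient_in subspace_add[OF subspace_V])
  next
    fix a :: real and v assume "0 < a" "H (a *\<^sub>R v) \<in> V"
    then have "(1 / a) *\<^sub>R H (a *\<^sub>R v) \<in> V" by (intro subspace_scale subspace_V)
    then show "H v \<in> V" using \<open>0 < a\<close> by (simp add: linear_scale[OF lin])
  qed
  have coer: "\<mu> * (norm v)\<^sup>2 \<le> H v \<bullet> v" if "v \<in> V" for v
  proof (rule small[OF that])
    fix v assume "v \<in> V" "norm v \<le> r"
    then show "\<mu> * (norm v)\<^sup>2 \<le> H v \<bullet> v"
      using strong_monotonicity[of "u + v" u] u by (simp add: inc subspace_add[OF subspace_V])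
  next
    fix a :: real and v assume a: "0 < a" "\<mu> * (norm (a *\<^sub>R v))\<^sup>2 \<le> H (a *\<^sub>R v) \<bullet> (a *\<^sub>R v)"
    then have "a\<^sup>2 * (\<mu> * (norm v)\<^sup>2) \<le> a\<^sup>2 * (H v \<bullet> v)"
      by (simp add: linear_scale[OF lin] power_mult_distrib power2_eq_square mult_ac)
    then show "\<mu> * (norm v)\<^sup>2 \<le> H v \<bullet> v" using a(1) by simp
  qed
  have bnd: "norm (H v) \<le> M * norm v" if "v \<in> V" for v
  proof (rule small[OF that])
    fix v assume "v \<in> V" "norm v \<le> r"
    then show "norm (H v) \<le> M * norm v"
      using lipschitz_sublevel[of "u + v" u] u ball[of v] by (simp add: inc subspace_add[OF subspace_V])
  next
    fix a :: real and v assume "0 < a" "norm (H (a *\<^sub>R v)) \<le> M * norm (a *\<^sub>R v)"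
    then show "norm (H v) \<le> M * norm v"
      by (simp add: linear_scale[OF lin] mult.left_commute)
  qed
  \<comment> \<open>Reaching \<open>u + v + x\<close> from \<open>u\<close> directly and through \<open>u + v\<close> gives the same value of \<open>f\<close>.\<close>
  have sym_small: "H x \<bullet> v = H v \<bullet> x"
    if x: "x \<in> V" "norm x \<le> r / 2" and v: "v \<in> V" "norm v \<le> r / 2" for x v
  proof -
    have xv: "v + x \<in> V" by (intro subspace_add subspace_V x v)
    have n: "norm (v + x) \<le> r" using norm_triangle_ineq[of v x] x v by linarith
    have vr: "norm v \<le> r" using v r by linarith
    have uv: "u + v \<in> V" and uvx: "u + (v + x) \<in> V"
      by (intro subspace_add subspace_V u v xv)+
    have "f (u + (v + x)) = f u + g u \<bullet> (v + x) + (H (v + x) \<bullet> (v + x)) / 2"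
      using quadratic_expansion[OF u uvx ball[OF xv n]] by simp
    moreover have "f (u + v) = f u + g u \<bullet> v + (H v \<bullet> v) / 2"
      using quadratic_expansion[OF u uv ball[OF v(1) vr]] by simp
    moreover have "f (u + (v + x)) = f (u + v) + g (u + v) \<bullet> x + (H x \<bullet> x) / 2"
      using quadratic_expansion[OF uv ball[OF v(1) vr] uvx ball[OF xv n]] by simp
    moreover have "g (u + v) = g u + H v" using inc[OF v(1) vr] by simp
    ultimately show ?thesis
      by (simp add: linear_add[OF lin] inner_add_left inner_add_right field_simps)
  qed
  have sym: "H x \<bullet> v = H v \<bullet> x" if "x \<in> V" "v \<in> V" for x v
  proof -
    have r2: "0 < r / 2" using r by simp
    let ?a = "r / 2 / (norm x + 1)" and ?b = "r / 2 / (norm v + 1)"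
    have "H (?a *\<^sub>R x) \<bullet> (?b *\<^sub>R v) = H (?b *\<^sub>R v) \<bullet> (?a *\<^sub>R x)"
      by (intro sym_small subspace_scale subspace_V that shrink r2)
    then have "(?a * ?b) * (H x \<bullet> v) = (?a * ?b) * (H v \<bullet> x)"
      by (simp add: linear_scale[OF lin] mult_ac)
    moreover have "?a * ?b \<noteq> 0" using shrink(1)[OF r2, of x] shrink(1)[OF r2, of v]
      by (metis less_irrefl mult_eq_0_iff)
    ultimately show ?thesis by (metis mult_left_cancel)
  qed
  obtain e where e: "e \<in> V" "e \<noteq> 0" using nontrivial by auto
  have "\<mu> * (norm e)\<^sup>2 \<le> norm (H e) * norm e"
    using coer[OF e(1)] norm_cauchy_schwarz[of "H e" e] by linarith
  also have "\<dots> \<le> (M * norm e) * norm e" by (intro mult_right_mono bnd e) simp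
  finally have "\<mu> \<le> M" using e(2) by (simp add: power2_eq_square flip: mult.assoc)
  then show ?thesis
    by (intro coercive_form.intro subspace_V lin H_in sym coer bnd \<mu>_pos)
qed

sublocale coercive_form V H M \<mu>
  by (rule hessian_coercive_form)

end

section \<open>The method inside the quadratic region\<close>

locale polak_ribiere_quadratic =
  polak_ribiere V f g L \<mu> d w p \<beta> \<eta> + quadratic_sublevel V f g L \<mu> c M H
  for V :: "'a::real_inner set" and f g L \<mu> d w p \<beta> \<eta> c M H +
  fixes B :: "'a set"
  assumes spanning: "finite B" "V \<subseteq> span B" "card B \<le> d"
begin

lemma values_decrease: "s \<le> t \<Longrightarrow> f (w t) \<le> f (w s)"
proof (induction rule: dec_induct)
  case (step n)
  have "f (w (Suc n)) \<le> f (w n)"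
    using line_search[of n 0] by (cases "g (w n) = 0") (auto simp: stop update)
  with step show ?case by simp
qed simp

context
  fixes r :: nat
  assumes r: "d dvd r" and inside: "f (w r) \<le> c"
begin

lemma stays_inside: "f (w (r + k)) \<le> c"
  using values_decrease[of r "r + k"] inside by simp

lemma gradient_difference: "g (w (r + j)) - g (w (r + k)) = H (w (r + j) - w (r + k))"
  by (rule gradient_affine[OF w_in stays_inside w_in stays_inside])

lemma first_direction: "g (w r) \<noteq> 0 \<Longrightarrow> p r = - g (w r)"
  using direction[of r] restart[OF r] by simp

text \<open>
  The affine gradient turns an update of the iterate into the recursion of \<open>conjugate_directions\<close>.  The
  bound \<open>n \<le> d\<close> keeps the next restart out, so that every \<open>\<beta>\<close> but the first is given by the
  Polak-Ribiere-Polyak formula.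
\<close>

lemma orthogonality_after_restart:
  assumes n: "n \<le> d" and nz: "\<And>k. k < n \<Longrightarrow> g (w (r + k)) \<noteq> 0" and kn: "k \<le> n" and ik: "i < k"
  shows "g (w (r + k)) \<bullet> p (r + i) = 0" "g (w (r + k)) \<bullet> g (w (r + i)) = 0"
proof -
  let ?G = "\<lambda>k. g (w (r + k))" and ?p = "\<lambda>k. p (r + k)"
  have p0: "?p 0 = - ?G 0" using first_direction nz[of 0] kn ik by simp
  have pS: "?p (Suc k) = - ?G (Suc k) + (?G (Suc k) \<bullet> (?G (Suc k) - ?G k) / (?G k \<bullet> ?G k)) *\<^sub>R ?p k"
    if "Suc k < n" for k
  proof -
    have "\<not> d dvd Suc k" using that n by (auto dest: dvd_imp_le)
    then have "\<not> d dvd r + Suc k" using r dvd_add_right_iff by blast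
    from prp[OF this] show ?thesis
      using direction[OF nz[OF that]] by (simp add: power2_norm_eq_inner inner_diff_right)
  qed
  have GS: "?G (Suc k) = ?G k + \<eta> (r + k) *\<^sub>R H (?p k)" if "k < n" for k
    using gradient_difference[of "Suc k" k] update[OF nz[OF that]]
    by (simp add: linear_scale[OF lin] algebra_simps)
  have symp: "H (?p i) \<bullet> ?p j = ?p i \<bullet> H (?p j)" if "i < n" "j < n" for i j
    using sym[OF p_in[OF nz[OF that(1)]] p_in[OF nz[OF that(2)]]] by (simp add: inner_commute)
  note cd = conjugate_directions[where n = n and G = ?G and p = ?p and \<eta> = "\<lambda>k. \<eta> (r + k)" and H = H,
      OF p0 pS GS _ _ nz symp kn]
  show "?G k \<bullet> ?p i = 0"
    by (rule cd(1)) (use gradient_orthogonal_direction nz step_nonzero ik in auto)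
  show "?G k \<bullet> ?G i = 0"
    by (rule cd(2)) (use gradient_orthogonal_direction nz step_nonzero ik in auto)
qed

text \<open>Otherwise \<open>V\<close> would contain \<open>d + 1\<close> nonzero, mutually orthogonal gradients.\<close>

lemma finite_termination: "g (w (r + d)) = 0"
proof (rule ccontr)
  assume nz: "g (w (r + d)) \<noteq> 0"
  have "d < card B"
  proof (rule pairwise_orthogonal_family_bound[of d "\<lambda>k. g (w (r + k))"])
    show "g (w (r + i)) \<noteq> 0" if "i \<le> d" for i
      using nonzero_before[OF nz] that by simp
    then show "g (w (r + j)) \<bullet> g (w (r + i)) = 0" if "j \<le> d" "i < j" for i j
      using that by (intro orthogonality_after_restart(2)[of j]) auto
    show "g (w (r + i)) \<in> span B" for i
      using gradient_in[OF w_in] spanning(2) by auto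
  qed (rule spanning)
  with spanning(3) show False by simp
qed

lemma optimal_after_period:
  assumes "v \<in> V" "r + d \<le> t"
  shows "f (w t) \<le> f v"
  using convexity[OF w_in assms(1), of "r + d"] finite_termination values_decrease[OF assms(2)] by simp

text \<open>
  The limit point needed to measure the error is supplied by \<open>finite_termination\<close>: it is
  \<open>w (r + d)\<close>, whose gradient vanishes, so \<open>f\<close> minus its value there is the energy of the error.
\<close>

lemma accelerated_rate:
  assumes k: "k \<le> d"
  shows "f (w (r + k)) - f (w (r + d)) \<le> 2 * (1 - sqrt (\<mu> / M)) ^ k * (f (w r) - f (w (r + d)))"
proof (cases "g (w (r + k)) = 0")
  case True
  then have "f (w (r + k)) \<le> f (w (r + d))" using convexity[OF w_in[of "r + k"] w_in[of "r + d"]] by simp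
  moreover have "0 \<le> 2 * (1 - sqrt (\<mu> / M)) ^ k * (f (w r) - f (w (r + d)))"
    using optimal_after_period[OF w_in[of r], of "r + d"] form_pos by (intro mult_nonneg_nonneg) auto
  ultimately show ?thesis by simp
next
  case False
  then have nz: "g (w (r + j)) \<noteq> 0" if "j \<le> k" for j
    using nonzero_before that by simp
  define e where "e j = w (r + j) - w (r + d)" for j
  define K where "K j = span (p ` {r..<r + j})" for j
  have He: "H (e j) = g (w (r + j))" for j
    using gradient_difference[of j d] finite_termination by (simp add: e_def)
  have gap: "f (w (r + j)) - f (w (r + d)) = energy (e j)" for j
    using quadratic_expansion[OF w_in stays_inside[of d] w_in stays_inside[of j]] finite_termination
    by (simp add: energy_def e_def)
  have p_K: "p (r + i) \<in> K j" if "i < j" for i j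
    unfolding K_def using that by (intro span_base) auto
  have K_mono: "mono K" unfolding K_def by (intro monoI span_mono image_mono) auto
  have K_sub: "subspace (K j)" for j by (simp add: K_def subspace_span)
  have g_K: "g (w (r + i)) \<in> K (Suc i)" if "i \<le> k" for i
  proof (cases i)
    case 0
    then have "g (w (r + i)) = - p (r + i)" using first_direction nz[of 0] by simp
    then show ?thesis using subspace_neg[OF K_sub p_K[of i "Suc i"]] by simp
  next
    case (Suc m)
    then have "g (w (r + i)) = \<beta> (r + i) *\<^sub>R p (r + m) - p (r + i)"
      using direction[OF nz[OF that]] by simp
    then show ?thesis
      using Suc p_K[of m "Suc i"] p_K[of i "Suc i"] by (simp only:) (intro subspace_diff subspace_scale K_sub; simp)
  qed
  have "energy (e k) \<le> 2 * (1 - sqrt (\<mu> / M)) ^ k * energy (e 0)"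
  proof (rule krylov_minimisers_rate[where K = K])
    show "K j \<subseteq> V" if "j \<le> k" for j
      unfolding K_def
    proof (rule span_minimal)
      have "p i \<in> V" if "i \<in> {r..<r + j}" for i
        using p_in[of i] nz[of "i - r"] that \<open>j \<le> k\<close> by auto
      then show "p ` {r..<r + j} \<subseteq> V" by auto
    qed (rule subspace_V)
    show "e 0 \<in> V" unfolding e_def by (intro diff_in w_in)
    show "e j - e 0 \<in> K j" if "j \<le> k" for j
      using that
    proof (induction j)
      case 0
      show ?case by (simp add: subspace_0[OF K_sub])
    next
      case (Suc j)
      have "e (Suc j) - e 0 = (e j - e 0) + \<eta> (r + j) *\<^sub>R p (r + j)"
        using update[OF nz[of j]] Suc.prems by (simp add: e_def)
      moreover have "e j - e 0 \<in> K (Suc j)"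
        using Suc monoD[OF K_mono, of j "Suc j"] by auto
      ultimately show ?case
        by (simp only:) (intro subspace_add subspace_scale K_sub p_K; simp)
    qed
    show "H (e 0) \<in> K 1" using g_K[of 0] He[of 0] by simp
    show "H v \<in> K (Suc j)" if "j < k" "v \<in> K j" for j v
    proof -
      have "H (p i) \<in> K (Suc j)" if "i \<in> {r..<r + j}" for i
      proof -
        define m where "m = i - r"
        have i: "i = r + m" and m: "m < j" using that by (auto simp: m_def)
        have gi: "g (w i) \<noteq> 0" using nz[of m] m \<open>j < k\<close> by (simp add: i)
        have "g (w (r + Suc m)) - g (w (r + m)) = \<eta> i *\<^sub>R H (p i)"
          using gradient_difference[of "Suc m" m] update[OF gi] by (simp add: i linear_scale[OF lin])
        then have "H (p i) = (1 / \<eta> i) *\<^sub>R (g (w (r + Suc m)) - g (w (r + m)))"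
          using step_nonzero[OF gi] by simp
        moreover have "g (w (r + Suc m)) \<in> K (Suc j)" "g (w (r + m)) \<in> K (Suc j)"
          using g_K[of "Suc m"] g_K[of m] m \<open>j < k\<close>
            monoD[OF K_mono, of "Suc (Suc m)" "Suc j"] monoD[OF K_mono, of "Suc m" "Suc j"] by auto
        ultimately show ?thesis
          by (simp only:) (intro subspace_scale subspace_diff K_sub)
      qed
      then have "H ` (p ` {r..<r + j}) \<subseteq> K (Suc j)" by auto
      then have "span (H ` (p ` {r..<r + j})) \<subseteq> K (Suc j)" by (rule span_minimal[OF _ K_sub])
      then show ?thesis
        using that(2) linear_span_image[OF lin, of "p ` {r..<r + j}"] unfolding K_def by auto
    qed
    show "H (e j) \<bullet> v = 0" if "j \<le> k" "v \<in> K j" for j v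
    proof -
      have "orthogonal (g (w (r + j))) x" if "x \<in> p ` {r..<r + j}" for x
      proof -
        from that obtain l where l: "l \<in> {r..<r + j}" "x = p l" by (elim imageE) simp
        define i where "i = l - r"
        have "x = p (r + i)" "i < j" using l by (auto simp: i_def)
        then show ?thesis
          using orthogonality_after_restart(1)[of j j i] nz \<open>j \<le> k\<close> k by (simp add: orthogonal_def)
      qed
      then show ?thesis
        using orthogonal_to_span[of v "p ` {r..<r + j}" "g (w (r + j))"] that(2)
        by (simp add: He K_def orthogonal_def)
    qed
  qed (use K_sub K_mono in auto)
  then show ?thesis using gap[of k] gap[of 0] by simp
qed

end

end

section \<open>Iteration count\<close>

lemma geometric_decay:
  fixes x a b :: real
  assumes "x \<le> 1" "0 < a" "0 < b" "ln (a / b) \<le> real n * x"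
  shows "(1 - x) ^ n * a \<le> b"
proof -
  have "(1 - x) ^ n \<le> exp (- x) ^ n"
    using exp_ge_add_one_self[of "- x"] assms(1) by (intro power_mono) auto
  also have "\<dots> = exp (- (real n * x))" by (simp flip: exp_of_nat_mult)
  also have "\<dots> \<le> exp (- ln (a / b))" using assms(4) by simp
  also have "\<dots> = b / a" using assms(2,3) by (simp add: exp_minus)
  finally show ?thesis using assms(2) by (simp add: field_simps)
qed

lemma next_multiple:
  fixes d t :: nat
  assumes "1 \<le> d"
  obtains r where "d dvd r" "t \<le> r" "r < t + d"
proof
  let ?r = "d * ((t + d - 1) div d)"
  show "d dvd ?r" by simp
  have "?r + (t + d - 1) mod d = t + d - 1" by (rule mult_div_mod_eq)
  moreover have "(t + d - 1) mod d < d" using assms by simp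
  ultimately show "t \<le> ?r" "?r < t + d" using assms by linarith+
qed

text \<open>
  The factor \<open>2\<close> in the accelerated rate is paid for by \<open>\<kappa>\<^sup>2\<close> inside the logarithm when the condition
  number \<open>\<kappa>\<close> is large, and by the additive constant when it is close to \<open>1\<close>.
\<close>

lemma accelerated_count:
  fixes \<mu> M \<delta> \<epsilon> k :: real
  assumes "0 < \<mu>" "\<mu> \<le> M" "0 < \<epsilon>" "\<epsilon> < \<delta>"
    and k: "4 + 4 * sqrt (M / \<mu>) * ln ((M / \<mu>)\<^sup>2 * (\<delta> / \<epsilon>)) \<le> k"
  shows "ln (2 * \<delta> / \<epsilon>) \<le> k * sqrt (\<mu> / M)"
proof -
  define \<kappa> where "\<kappa> = M / \<mu>"
  define \<theta> where "\<theta> = sqrt (\<mu> / M)"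
  have \<kappa>: "1 \<le> \<kappa>" using assms by (simp add: \<kappa>_def)
  have \<theta>: "0 < \<theta>" using assms by (simp add: \<theta>_def)
  have prod: "sqrt \<kappa> * \<theta> = 1" using assms by (simp add: \<kappa>_def \<theta>_def flip: real_sqrt_mult)
  have ratio: "1 < \<delta> / \<epsilon>" using assms by simp
  have "ln (\<kappa>\<^sup>2 * (\<delta> / \<epsilon>)) = ln (\<kappa>\<^sup>2) + ln (\<delta> / \<epsilon>)"
    using \<kappa> ratio by (intro ln_mult_pos) auto
  then have ln\<kappa>: "ln (\<kappa>\<^sup>2 * (\<delta> / \<epsilon>)) = 2 * ln \<kappa> + ln (\<delta> / \<epsilon>)"
    using \<kappa> by (simp add: ln_realpow)
  have pos: "0 \<le> ln \<kappa>" "0 \<le> ln (\<delta> / \<epsilon>)" using \<kappa> ratio by auto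
  have ln2: "ln 2 \<le> (1 :: real)" using ln_2_less_1 by simp
  have "ln 2 \<le> 4 * \<theta> + 8 * ln \<kappa>"
  proof (cases "\<kappa> \<le> 4")
    case True
    then have "sqrt \<kappa> \<le> 2" using real_sqrt_le_mono[of \<kappa> 4] by simp
    then have "1 \<le> 2 * \<theta>" using prod \<theta> mult_right_mono[of "sqrt \<kappa>" 2 \<theta>] by simp
    then show ?thesis using pos ln2 by linarith
  next
    case False
    then have "ln 2 \<le> ln \<kappa>" by simp
    then show ?thesis using pos \<theta> by linarith
  qed
  then have "ln 2 + ln (\<delta> / \<epsilon>) \<le> 4 * \<theta> + 4 * ln (\<kappa>\<^sup>2 * (\<delta> / \<epsilon>))"
    using ln\<kappa> pos by linarith
  also have "\<dots> = (4 + 4 * sqrt \<kappa> * ln (\<kappa>\<^sup>2 * (\<delta> / \<epsilon>))) * \<theta>"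
    using prod by (simp add: algebra_simps)
  also have "\<dots> \<le> k * \<theta>" using k \<theta> by (intro mult_right_mono) (auto simp: \<kappa>_def)
  finally have "ln 2 + ln (\<delta> / \<epsilon>) \<le> k * \<theta>" .
  moreover have "ln (2 * (\<delta> / \<epsilon>)) = ln 2 + ln (\<delta> / \<epsilon>)"
    using ratio by (intro ln_mult_pos) auto
  ultimately show ?thesis by (simp add: \<theta>_def)
qed

lemma (in polak_ribiere) global_rate:
  assumes bdd: "bdd_below (f ` V)" and nontrivial: "\<exists>v\<in>V. v \<noteq> 0"
    and x: "0 < x" and gap: "0 < f (w 0) - (INF v\<in>V. f v)"
    and t: "2 * (L\<^sup>2 / \<mu>\<^sup>2) * ln ((f (w 0) - (INF v\<in>V. f v)) / x) \<le> real t"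
  shows "f (w t) - (INF v\<in>V. f v) \<le> x"
proof -
  define m where "m = (INF v\<in>V. f v)"
  define a where "a = \<mu>\<^sup>2 / (2 * L\<^sup>2)"
  have "\<mu> \<le> L" using nontrivial modulus_le_lipschitz by auto
  then have "\<mu>\<^sup>2 \<le> L\<^sup>2" using \<mu>_pos by (intro power_mono) auto
  moreover have "0 < L\<^sup>2" using L_pos by simp
  ultimately have "\<mu>\<^sup>2 \<le> 2 * L\<^sup>2" by linarith
  then have a: "0 < a" "a \<le> 1" using L_pos \<mu>_pos by (auto simp: a_def)
  have decay: "f (w s) - m \<le> (1 - a) ^ s * (f (w 0) - m)" for s
  proof (induction s)
    case (Suc s)
    have "f (w (Suc s)) - m \<le> (1 - a) * (f (w s) - m)"
      unfolding m_def a_def by (rule gap_contraction[OF bdd])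
    also have "\<dots> \<le> (1 - a) * ((1 - a) ^ s * (f (w 0) - m))"
      using a Suc by (intro mult_left_mono) auto
    finally show ?case by (simp add: mult.assoc)
  qed simp
  have "2 * (L\<^sup>2 / \<mu>\<^sup>2) * a = 1" using L_pos \<mu>_pos by (simp add: a_def)
  then have "ln ((f (w 0) - m) / x) = (2 * (L\<^sup>2 / \<mu>\<^sup>2) * ln ((f (w 0) - m) / x)) * a"
    by (metis mult.assoc mult.commute mult_1)
  also have "\<dots> \<le> real t * a" using t a by (intro mult_right_mono) (auto simp: m_def)
  finally have "(1 - a) ^ t * (f (w 0) - m) \<le> x"
    using a x gap by (intro geometric_decay) (auto simp: m_def)
  then show ?thesis using decay[of t] by (simp add: m_def)
qed

section \<open>Coordinate space\<close>

lemma Rd_subset_span: "Rd d \<subseteq> span ((\<lambda>i. Poly_Mapping.single i 1) ` {..<d})"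
proof
  fix x assume "x \<in> Rd d"
  then have "x = (\<Sum>i<d. Poly_Mapping.lookup x i *\<^sub>R Poly_Mapping.single i 1)"
    by (intro poly_mapping_eqI)
      (auto simp: lookup_sum lookup_scaleR lookup_single when_def Rd_def in_keys_iff subset_iff
        if_distrib[of "\<lambda>x. _ * x"] cong: if_cong)
  moreover have "\<dots> \<in> span ((\<lambda>i. Poly_Mapping.single i 1) ` {..<d})"
    by (intro span_sum span_scale span_base) auto
  ultimately show "x \<in> span ((\<lambda>i. Poly_Mapping.single i 1) ` {..<d})" by simp
qed

lemma smooth_strongly_convex_Rd:
  assumes smooth: "glocally_smooth d f L Ls \<delta>" and \<mu>: "\<mu> > 0" and convex: "strongly_convex d f \<mu>"
  shows "smooth_strongly_convex (Rd d) f (grad d f) L \<mu>"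
proof
  fix u assume "u \<in> Rd d"
  moreover from this have "f differentiable (at u within Rd d)"
    using smooth by (simp add: glocally_smooth_def differentiable_on_def)
  ultimately show "grad d f u \<in> Rd d"
    and "(f has_derivative (\<lambda>h. grad d f u \<bullet> h)) (at u within Rd d)"
    by (auto intro: grad_props)
qed (use assms subspace_Rd in \<open>auto simp: glocally_smooth_def strongly_convex_def\<close>)

section \<open>The iteration bound\<close>

theorem theorem12:
  "\<exists>C>0. \<forall>(d :: nat) (f :: (nat \<Rightarrow>\<^sub>0 real) \<Rightarrow> real) (L :: real) (Ls :: real) (\<delta> :: real)
      (\<mu> :: real) (\<epsilon> :: real) (w :: nat \<Rightarrow> nat \<Rightarrow>\<^sub>0 real) (\<Delta>0 :: real).
    d \<ge> 1 \<longrightarrow>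
    glocally_smooth d f L Ls \<delta> \<longrightarrow>
    \<mu> > 0 \<longrightarrow>
    strongly_convex d f \<mu> \<longrightarrow>
    constant_Hessian_on d f (sublevel d f \<delta>) \<longrightarrow>
    prp_cg_iterates d f w \<longrightarrow>
    \<Delta>0 = f (w 0) - inf_val d f \<longrightarrow>
    \<Delta>0 > \<delta> \<longrightarrow> \<delta> > \<epsilon> \<longrightarrow> \<epsilon> > 0 \<longrightarrow>
    (\<forall>T :: nat.
      real T \<ge> C * (L\<^sup>2 / \<mu>\<^sup>2 * ln (\<Delta>0 / \<delta>) + 1)
        + min (C * (L\<^sup>2 / \<mu>\<^sup>2) * ln (\<delta> / \<epsilon>))
              (real d + min (real d) (C * sqrt (Ls / \<mu>) * ln ((Ls / \<mu>)\<^sup>2 * (\<delta> / \<epsilon>))))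
      \<longrightarrow> f (w T) - inf_val d f \<le> \<epsilon>)"
proof (intro exI[of _ "4 :: real"] conjI allI impI)
  fix d :: nat and f :: "(nat \<Rightarrow>\<^sub>0 real) \<Rightarrow> real" and L Ls \<delta> \<mu> \<epsilon> :: real
    and w :: "nat \<Rightarrow> nat \<Rightarrow>\<^sub>0 real" and \<Delta>0 :: real and T :: nat
  assume d: "1 \<le> d" and smooth: "glocally_smooth d f L Ls \<delta>" and \<mu>: "\<mu> > 0"
    and convex: "strongly_convex d f \<mu>" and const: "constant_Hessian_on d f (sublevel d f \<delta>)"
    and iter: "prp_cg_iterates d f w" and \<Delta>0: "\<Delta>0 = f (w 0) - inf_val d f"
    and \<Delta>: "\<Delta>0 > \<delta>" and \<delta>: "\<delta> > \<epsilon>" and \<epsilon>: "\<epsilon> > 0"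
    and T: "real T \<ge> 4 * (L\<^sup>2 / \<mu>\<^sup>2 * ln (\<Delta>0 / \<delta>) + 1)
        + min (4 * (L\<^sup>2 / \<mu>\<^sup>2) * ln (\<delta> / \<epsilon>))
              (real d + min (real d) (4 * sqrt (Ls / \<mu>) * ln ((Ls / \<mu>)\<^sup>2 * (\<delta> / \<epsilon>))))"
  define m where "m = inf_val d f"
  have m: "m = (INF v\<in>Rd d. f v)" by (simp add: m_def inf_val_def)
  have bdd: "bdd_below (f ` Rd d)" using smooth by (simp add: glocally_smooth_def)
  have m_le: "m \<le> f v" if "v \<in> Rd d" for v unfolding m by (rule cINF_lower[OF bdd that])
  interpret P: smooth_strongly_convex "Rd d" f "grad d f" L \<mu>
    by (rule smooth_strongly_convex_Rd[OF smooth \<mu> convex])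
  obtain p \<eta> where steps: "\<And>t. if grad d f (w t) = 0 then w (Suc t) = w t
      else p t = - grad d f (w t) + prp_beta d f w t *\<^sub>R p (t - 1) \<and>
           is_arg_min (\<lambda>s. f (w t + s *\<^sub>R p t)) (\<lambda>_. True) (\<eta> t) \<and>
           w (Suc t) = w t + \<eta> t *\<^sub>R p t"
    using iter unfolding prp_cg_iterates_def by blast
  have w0: "w 0 \<in> Rd d" using iter by (simp add: prp_cg_iterates_def)
  interpret P: polak_ribiere "Rd d" f "grad d f" L \<mu> d w p "prp_beta d f w" \<eta>
  proof
    fix t and s :: real assume "grad d f (w t) \<noteq> 0"
    then show "f (w t + \<eta> t *\<^sub>R p t) \<le> f (w t + s *\<^sub>R p t)"
      using steps[of t] unfolding is_arg_min_linorder by metis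
  qed (use w0 steps in \<open>auto simp: prp_beta_def split: if_splits\<close>)
  obtain H where H: "\<And>u. u \<in> sublevel d f \<delta> \<Longrightarrow> (grad d f has_derivative H) (at u within Rd d)"
    using const by (auto simp: constant_Hessian_on_def)
  have sub: "u \<in> sublevel d f \<delta> \<longleftrightarrow> u \<in> Rd d \<and> f u \<le> m + \<delta>" for u
    by (auto simp: sublevel_def m_def)
  have nontrivial: "\<exists>v\<in>Rd d. v \<noteq> 0"
  proof
    show "Poly_Mapping.single 0 1 \<in> Rd d" using d by (simp add: Rd_def)
  qed simp
  have strict: "\<exists>u\<in>Rd d. f u < m + \<delta>"
    using cINF_less_iff[OF _ bdd, of "m + \<delta>"] w0 \<delta> \<epsilon> by (auto simp: m)
  interpret P: polak_ribiere_quadratic "Rd d" f "grad d f" L \<mu> d w p "prp_beta d f w" \<eta>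
    "m + \<delta>" Ls H "(\<lambda>i. Poly_Mapping.single i 1) ` {..<d}"
  proof
    show "card ((\<lambda>i. Poly_Mapping.single i (1 :: real)) ` {..<d}) \<le> d"
      using card_image_le[of "{..<d}" "\<lambda>i. Poly_Mapping.single i (1 :: real)"] by simp
    show "norm (grad d f u - grad d f v) \<le> Ls * norm (u - v)"
      if "u \<in> Rd d" "v \<in> Rd d" "f u \<le> m + \<delta>" "f v \<le> m + \<delta>" for u v
      using smooth that by (simp add: glocally_smooth_def sub)
  qed (use nontrivial strict Rd_subset_span H in \<open>auto simp: sub\<close>)
  define \<kappa> where "\<kappa> = L\<^sup>2 / \<mu>\<^sup>2"
  have \<kappa>: "0 \<le> \<kappa>" by (simp add: \<kappa>_def)
  define A where "A = ln (\<Delta>0 / \<delta>)"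
  have A: "0 \<le> A" using \<Delta> \<delta> \<epsilon> by (simp add: A_def)
  have \<kappa>A: "0 \<le> \<kappa> * A" using \<kappa> A by simp
  define E where "E = ln (\<delta> / \<epsilon>)"
  have E: "0 \<le> E" using \<delta> \<epsilon> by (simp add: E_def)
  define N where "N = 4 * sqrt (Ls / \<mu>) * ln ((Ls / \<mu>)\<^sup>2 * (\<delta> / \<epsilon>))"
  have N: "0 \<le> N"
  proof -
    have "1 * 1 \<le> (Ls / \<mu>)\<^sup>2 * (\<delta> / \<epsilon>)"
      using P.form_pos \<delta> \<epsilon> by (intro mult_mono) auto
    then show ?thesis using P.form_pos unfolding N_def by (intro mult_nonneg_nonneg) auto
  qed
  have rate: "f (w t) - m \<le> x" if "0 < x" "2 * \<kappa> * ln (\<Delta>0 / x) \<le> real t" for x t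
    using P.global_rate[OF bdd nontrivial that(1), of t] that(2) \<Delta> \<delta> \<epsilon>
    by (simp add: \<Delta>0 m_def inf_val_def \<kappa>_def)
  \<comment> \<open>Failure of the first alternative leaves the second branch of the minimum, and then the iteration
    count is split at the first restart \<open>r\<close> after the region has been reached.\<close>
  have "f (w T) - m \<le> \<epsilon>"
  proof (cases "real T \<ge> 4 * (\<kappa> * A + 1) + 4 * \<kappa> * E")
    case True
    have "ln ((\<Delta>0 / \<delta>) * (\<delta> / \<epsilon>)) = A + E"
      unfolding A_def E_def using \<Delta> \<delta> \<epsilon> by (intro ln_mult_pos) auto
    then have "ln (\<Delta>0 / \<epsilon>) = A + E" using \<delta> \<epsilon> by simp
    then have "2 * \<kappa> * ln (\<Delta>0 / \<epsilon>) = 2 * (\<kappa> * A) + 2 * (\<kappa> * E)" by (simp add: algebra_simps)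
    moreover have "0 \<le> \<kappa> * E" using \<kappa> E by simp
    ultimately have "2 * \<kappa> * ln (\<Delta>0 / \<epsilon>) \<le> real T" using True \<kappa>A by simp
    then show ?thesis by (rule rate[OF \<epsilon>])
  next
    case False
    then have T': "real T \<ge> 4 * (\<kappa> * A + 1) + (real d + min (real d) N)"
      using T unfolding \<kappa>_def A_def E_def N_def by linarith
    define t where "t = nat \<lceil>2 * \<kappa> * A\<rceil>"
    have t: "2 * \<kappa> * A \<le> real t" "real t \<le> 2 * (\<kappa> * A) + 1"
      using \<kappa>A unfolding t_def by (auto simp: mult.assoc)
    obtain r where r: "d dvd r" "t \<le> r" "r < t + d" using next_multiple[OF d] by metis
    have "f (w r) \<le> f (w t)" by (rule P.values_decrease[OF r(2)])
    moreover have "f (w t) - m \<le> \<delta>" using t(1) \<delta> \<epsilon> by (intro rate) (auto simp: A_def)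
    ultimately have inside: "f (w r) \<le> m + \<delta>" by simp
    have "real r + 1 \<le> real t + real d" using r(3) by linarith
    then have r_le: "real r \<le> 2 * (\<kappa> * A) + real d" using t(2) by linarith
    have minimal: "f (w s) = m" if "r + d \<le> s" for s
    proof (rule antisym)
      show "f (w s) \<le> m"
        unfolding m by (rule cINF_greatest) (use w0 P.optimal_after_period[OF r(1) inside _ that] in auto)
    qed (rule m_le[OF P.w_in])
    show ?thesis
    proof (cases "r + d \<le> T")
      case True
      then show ?thesis using minimal[of T] \<epsilon> by simp
    next
      case late: False
      have "min (real d) N = N"
      proof (rule ccontr)
        assume "min (real d) N \<noteq> N"
        then have "min (real d) N = real d" by linarith
        then have "real r + real d \<le> real T" using T' r_le \<kappa>A by (simp add: algebra_simps)
        with late show False by linarith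
      qed
      then have Tr: "4 + N \<le> real T - real r" using T' r_le \<kappa>A by (simp add: algebra_simps)
      define k where "k = T - r"
      have "real r \<le> real T" using Tr N by linarith
      then have k: "T = r + k" "k \<le> d" "4 + N \<le> real k"
        using Tr late by (auto simp: k_def of_nat_diff)
      have "f (w T) - m \<le> 2 * (1 - sqrt (\<mu> / Ls)) ^ k * (f (w r) - m)"
        using P.accelerated_rate[OF r(1) inside k(2)] minimal[of "r + d"] k(1) by simp
      also have "\<dots> \<le> 2 * (1 - sqrt (\<mu> / Ls)) ^ k * \<delta>"
        using inside P.form_pos by (intro mult_left_mono) auto
      also have "\<dots> = (1 - sqrt (\<mu> / Ls)) ^ k * (2 * \<delta>)" by simp
      also have "\<dots> \<le> \<epsilon>"
        using accelerated_count[OF P.form_pos \<epsilon> \<delta>, of "real k"] k(3) \<delta> \<epsilon> P.form_pos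
        by (intro geometric_decay) (auto simp: N_def)
      finally show ?thesis .
    qed
  qed
  then show "f (w T) - inf_val d f \<le> \<epsilon>" by (simp add: m_def)
qed simp

end
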